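(* There exist countable ICC groups $G$ and $H$ such that $G$ and $H$ are elementarily equivalent, $G$ is amenable, and $H$ is not inner amenable.
   Context: An action $G\curvearrowright X$ of a group $G$ on a set $X$ is called amenable if there is a finitely additive $G$-invariant probability measure defined on all subsets of $X$. A group $G$ is amenable if the action of $G$ on itself by left multiplication is amenable. A group $G$ is inner amenable if the action of $G$ on $G\setminus\{e\}$ by conjugation is amenable. A group is ICC if it is nontrivial and the conjugacy class of every nonidentity element is infinite (so an ICC group is infinite). Two groups are elementarily equivalent if they satisfy the same first-order sentences in the language of groups. *)

theory Defs
  imports "HOL-Algebra.Group_Action" "HOL-Analysis.Measure_Space"
begin

section \<open>Amenable actions and amenable groups\<close>

text \<open>Since \<open>m\<close> takes finite real values, additivity forces \<open>m {} = 0\<close>. The value of \<open>m\<close> on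
  sets that are not contained in \<open>X\<close> is irrelevant.\<close>

definition fin_additive_prob :: "'x set \<Rightarrow> ('x set \<Rightarrow> real) \<Rightarrow> bool" where
  "fin_additive_prob X m \<longleftrightarrow>
     (\<forall>A\<in>Pow X. 0 \<le> m A) \<and> additive (Pow X) m \<and> m X = 1"

text \<open>Meant for \<open>group_action G X \<phi>\<close>; this is proved below for each action to which the
  definition is applied.\<close>

definition amenable_action ::
  "('g, 'r) monoid_scheme \<Rightarrow> 'x set \<Rightarrow> ('g \<Rightarrow> 'x \<Rightarrow> 'x) \<Rightarrow> bool" where
  "amenable_action G X \<phi> \<longleftrightarrow>
     (\<exists>m. fin_additive_prob X m \<and> (\<forall>g\<in>carrier G. \<forall>A\<in>Pow X. m (\<phi> g ` A) = m A))"

definition left_mult :: "('g, 'r) monoid_scheme \<Rightarrow> 'g \<Rightarrow> 'g \<Rightarrow> 'g" where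
  "left_mult G = (\<lambda>g. \<lambda>x\<in>carrier G. g \<otimes>\<^bsub>G\<^esub> x)"

definition conjugation :: "('g, 'r) monoid_scheme \<Rightarrow> 'g \<Rightarrow> 'g \<Rightarrow> 'g" where
  "conjugation G = (\<lambda>g. \<lambda>x\<in>carrier G. g \<otimes>\<^bsub>G\<^esub> x \<otimes>\<^bsub>G\<^esub> inv\<^bsub>G\<^esub> g)"

definition nonidentity :: "('g, 'r) monoid_scheme \<Rightarrow> 'g set" where
  "nonidentity G = carrier G - {\<one>\<^bsub>G\<^esub>}"

definition amenable_group :: "('g, 'r) monoid_scheme \<Rightarrow> bool" where
  "amenable_group G \<longleftrightarrow> amenable_action G (carrier G) (left_mult G)"

definition inner_amenable :: "('g, 'r) monoid_scheme \<Rightarrow> bool" where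
  "inner_amenable G \<longleftrightarrow>
     amenable_action G (nonidentity G) (\<lambda>g. restrict (conjugation G g) (nonidentity G))"

definition icc :: "('g, 'r) monoid_scheme \<Rightarrow> bool" where
  "icc G \<longleftrightarrow> carrier G \<noteq> {\<one>\<^bsub>G\<^esub>} \<and> (\<forall>x\<in>nonidentity G. infinite (orbit G (conjugation G) x))"

lemma (in group) group_action_restrictI:
  assumes closed: "\<And>g x. g \<in> carrier G \<Longrightarrow> x \<in> E \<Longrightarrow> f g x \<in> E"
    and one: "\<And>x. x \<in> E \<Longrightarrow> f \<one> x = x"
    and mult: "\<And>g h x. g \<in> carrier G \<Longrightarrow> h \<in> carrier G \<Longrightarrow> x \<in> E \<Longrightarrow> f (g \<otimes> h) x = f g (f h x)"
  shows "group_action G E (\<lambda>g. restrict (f g) E)"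
proof -
  have bij: "restrict (f g) E \<in> Bij E" if g: "g \<in> carrier G" for g
  proof -
    have l: "f (inv g) (f g x) = x" if "x \<in> E" for x
      using mult[OF inv_closed[OF g] g that] one[OF that] g by simp
    have r: "f g (f (inv g) x) = x" if "x \<in> E" for x
      using mult[OF g inv_closed[OF g] that] one[OF that] g by simp
    have "bij_betw (f g) E E"
      using l r closed[OF g] closed[OF inv_closed[OF g]]
      by (intro bij_betw_byWitness[where f' = "f (inv g)"]) blast+
    then show ?thesis by (simp add: Bij_def)
  qed
  have "(\<lambda>g. restrict (f g) E) \<in> hom G (BijGroup E)"
  proof (rule homI)
    show "restrict (f g) E \<in> carrier (BijGroup E)" if "g \<in> carrier G" for g
      using bij[OF that] by (simp add: BijGroup_def)
    fix g h assume g: "g \<in> carrier G" and h: "h \<in> carrier G"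
    have "restrict (f g) E \<otimes>\<^bsub>BijGroup E\<^esub> restrict (f h) E = compose E (restrict (f g) E) (restrict (f h) E)"
      using bij[OF g] bij[OF h] by (simp only: BijGroup_def monoid.simps restrict_apply')
    also have "\<dots> = restrict (f (g \<otimes> h)) E"
      by (rule ext) (simp add: compose_def restrict_def closed[OF h] mult[OF g h])
    finally show "restrict (f (g \<otimes> h)) E = restrict (f g) E \<otimes>\<^bsub>BijGroup E\<^esub> restrict (f h) E" ..
  qed
  then show ?thesis
    by (simp add: group_action_def group_hom_def group_hom_axioms_def group_BijGroup is_group)
qed

lemma (in group) group_action_left_mult: "group_action G (carrier G) (left_mult G)"
  unfolding left_mult_def by (rule group_action_restrictI) (simp_all add: m_assoc)

lemma (in group) group_action_conjugation: "group_action G (carrier G) (conjugation G)"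
  unfolding conjugation_def by (rule action_by_conjugation)

lemma (in group) group_action_conjugation_nonidentity:
  "group_action G (nonidentity G) (\<lambda>g. restrict (conjugation G g) (nonidentity G))"
proof (rule group_action_restrictI)
  fix g x assume g: "g \<in> carrier G" and x: "x \<in> nonidentity G"
  have xc: "x \<in> carrier G" "x \<noteq> \<one>"
    using x by (auto simp: nonidentity_def)
  have "g \<otimes> x \<otimes> inv g \<noteq> \<one>"
  proof
    assume "g \<otimes> x \<otimes> inv g = \<one>"
    also have "\<one> = g \<otimes> \<one> \<otimes> inv g"
      using g by simp
    finally have "x = \<one>"
      by (rule conjugation_is_inj[OF g xc(1) one_closed])
    then show False
      using xc(2) by contradiction
  qed
  then show "conjugation G g x \<in> nonidentity G"
    using g xc by (simp add: nonidentity_def conjugation_def)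
next
  fix x assume "x \<in> nonidentity G"
  then show "conjugation G \<one> x = x"
    by (simp add: nonidentity_def conjugation_def)
next
  fix g h x assume "g \<in> carrier G" "h \<in> carrier G" "x \<in> nonidentity G"
  then show "conjugation G (g \<otimes> h) x = conjugation G g (conjugation G h x)"
    by (simp add: nonidentity_def conjugation_def inv_mult_group m_assoc)
qed


section \<open>First-order sentences in the language of groups\<close>

text \<open>The variables are \<open>v\<^sub>0, v\<^sub>1, \<dots>\<close>, represented by their indices. The remaining connectives and
  the universal quantifier are definable as usual.\<close>

datatype gterm =
    Var nat
  | Unit
  | Mult gterm gterm
  | Inv gterm

datatype gformula =
    Eq gterm gterm
  | Neg gformula
  | Conj gformula gformula
  | Exists nat gformula

primrec gterm_vars :: "gterm \<Rightarrow> nat set" where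
  "gterm_vars (Var n) = {n}"
| "gterm_vars Unit = {}"
| "gterm_vars (Mult s t) = gterm_vars s \<union> gterm_vars t"
| "gterm_vars (Inv t) = gterm_vars t"

primrec free_vars :: "gformula \<Rightarrow> nat set" where
  "free_vars (Eq s t) = gterm_vars s \<union> gterm_vars t"
| "free_vars (Neg p) = free_vars p"
| "free_vars (Conj p q) = free_vars p \<union> free_vars q"
| "free_vars (Exists n p) = free_vars p - {n}"

definition sentence :: "gformula \<Rightarrow> bool" where
  "sentence p \<longleftrightarrow> free_vars p = {}"

primrec gterm_val :: "('g, 'r) monoid_scheme \<Rightarrow> (nat \<Rightarrow> 'g) \<Rightarrow> gterm \<Rightarrow> 'g" where
  "gterm_val G v (Var n) = v n"
| "gterm_val G v Unit = \<one>\<^bsub>G\<^esub>"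
| "gterm_val G v (Mult s t) = gterm_val G v s \<otimes>\<^bsub>G\<^esub> gterm_val G v t"
| "gterm_val G v (Inv t) = inv\<^bsub>G\<^esub> (gterm_val G v t)"

primrec sat :: "('g, 'r) monoid_scheme \<Rightarrow> (nat \<Rightarrow> 'g) \<Rightarrow> gformula \<Rightarrow> bool" where
  "sat G v (Eq s t) \<longleftrightarrow> gterm_val G v s = gterm_val G v t"
| "sat G v (Neg p) \<longleftrightarrow> \<not> sat G v p"
| "sat G v (Conj p q) \<longleftrightarrow> sat G v p \<and> sat G v q"
| "sat G v (Exists n p) \<longleftrightarrow> (\<exists>x\<in>carrier G. sat G (v(n := x)) p)"

text \<open>For a sentence the choice of assignment does not matter, see \<open>satisfies_iff\<close>.\<close>

definition satisfies :: "('g, 'r) monoid_scheme \<Rightarrow> gformula \<Rightarrow> bool" where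
  "satisfies G p \<longleftrightarrow> (\<forall>v \<in> UNIV \<rightarrow> carrier G. sat G v p)"

definition elementarily_equivalent ::
  "('g, 'r) monoid_scheme \<Rightarrow> ('h, 's) monoid_scheme \<Rightarrow> bool" where
  "elementarily_equivalent G H \<longleftrightarrow> (\<forall>p. sentence p \<longrightarrow> (satisfies G p \<longleftrightarrow> satisfies H p))"

lemma gterm_val_cong:
  "\<forall>n\<in>gterm_vars t. v n = w n \<Longrightarrow> gterm_val G v t = gterm_val G w t"
  by (induction t) (simp_all add: ball_Un)

lemma sat_cong: "\<forall>n\<in>free_vars p. v n = w n \<Longrightarrow> sat G v p \<longleftrightarrow> sat G w p"
proof (induction p arbitrary: v w)
  case (Eq s t)
  have "gterm_val G v s = gterm_val G w s" "gterm_val G v t = gterm_val G w t"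
    using Eq by (auto intro!: gterm_val_cong)
  then show ?case by simp
next
  case (Neg p)
  have "sat G v p \<longleftrightarrow> sat G w p"
    using Neg.prems by (intro Neg.IH) simp
  then show ?case by simp
next
  case (Conj p q)
  have "sat G v p \<longleftrightarrow> sat G w p" "sat G v q \<longleftrightarrow> sat G w q"
    using Conj.prems by (intro Conj.IH; simp)+
  then show ?case by simp
next
  case (Exists n p)
  have "sat G (v(n := x)) p \<longleftrightarrow> sat G (w(n := x)) p" for x
    using Exists.prems by (intro Exists.IH) auto
  then show ?case by simp
qed

lemma satisfies_iff:
  assumes "sentence p" and "v \<in> UNIV \<rightarrow> carrier G"
  shows "satisfies G p \<longleftrightarrow> sat G v p"
proof -
  have "sat G v p \<longleftrightarrow> sat G w p" for w
    using assms(1) by (intro sat_cong) (simp add: sentence_def)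
  then show ?thesis
    using assms(2) unfolding satisfies_def by metis
qed

end

theory Submission
  imports Defs "HOL-Library.Countable" "HOL-Library.Z2" "HOL-Algebra.Algebraic_Closure_Type"
    "HOL-Analysis.Determinants" "HOL-Analysis.Elementary_Topology"
begin

text \<open>The amenable group is \<open>G = SL\<^sub>2(k)\<close>, where \<open>k\<close> is the algebraic closure of the field with two
  elements, and \<open>H\<close> is a countable elementary subgroup of an ultrapower of \<open>G\<close>. Characteristic two
  makes the centre trivial, so that a nonidentity element of \<open>SL\<^sub>2\<close> fixes at most two points of the
  projective line; over an algebraically closed field it fixes at least one.

  Every element of \<open>k\<close> is periodic under the Frobenius map, so \<open>k\<close> is an increasing union of
  finite fields and \<open>G\<close> is a directed union of finite groups. An ultralimit of their uniform measures
  is an invariant mean (\<open>amenable_group_locally_finite\<close>). The conjugacy classes of \<open>G\<close> are infinite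
  because conjugation by unipotent matrices already produces infinitely many conjugates
  (\<open>infinite_conjugates_SL2\<close>).

  A Skolem hull inside the ultrapower, together with the theorem of Los, gives a countable group that
  is elementarily equivalent to \<open>G\<close> and contains any prescribed countable family of sequences
  (\<open>countable_elementary_subgroup_of_ultrapower\<close>). It consists of matrices over the ultrapower \<open>K\<close>
  of \<open>k\<close>. A sequence of distinct elements of \<open>k\<close> represents an element \<open>t\<close> of \<open>K\<close> that is
  transcendental over \<open>k\<close>, so \<open>1/t\<close> does not lie in \<open>k[t]\<close>; by Zorn's lemma \<open>k[t]\<close> extends
  to a valuation ring \<open>V\<close> of \<open>K\<close> with \<open>t\<close> in its maximal ideal (\<open>exists_valuation_ring\<close>). For
  \<open>a\<close> in \<open>k\<close> the matrix \<open>hyperbolic a t\<close> has eigenvalues \<open>t\<close> and \<open>1/t\<close>; it attracts to the point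
  \<open>a\<close> of the projective line everything outside a small neighbourhood of \<open>a + 1\<close>. Such
  matrices, for infinitely many \<open>a\<close>, are put into \<open>H\<close>; four of them are needed.

  Suppose that \<open>H\<close> had a conjugation-invariant mean on its nonidentity elements. Send each element to
  its set of one or two fixed points. Let \<open>\<alpha>\<^sub>i\<close> be the mean of the elements with a fixed point in the
  \<open>i\<close>-th repelling neighbourhood, and \<open>\<beta>\<^sub>i\<close> the mean of those whose fixed points all lie in the
  \<open>i\<close>-th attracting neighbourhood. Conjugation by the \<open>i\<close>-th matrix gives \<open>1 - \<alpha>\<^sub>i \<le> \<beta>\<^sub>i\<close>. The
  attracting neighbourhoods are disjoint, so the \<open>\<beta>\<^sub>i\<close> sum to at most 1; no element has fixed points
  in three of the disjoint repelling neighbourhoods, so the \<open>\<alpha>\<^sub>i\<close> sum to at most 2. Summation over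
  four indices yields \<open>4 \<le> 3\<close> (\<open>not_inner_amenable_if_ping_pong\<close>).

  Finally, a finite nontrivial conjugacy class would carry an invariant mean, so \<open>H\<close> is ICC because
  it is not inner amenable (\<open>icc_if_not_inner_amenable\<close>).\<close>

(* The infix $ denotes entries of vectors and matrices only. *)
no_notation fps_nth (infixl \<open>$\<close> 75)

section \<open>Ultralimits along a free ultrafilter on the natural numbers\<close>

text \<open>A filter that is minimal among the proper filters below \<open>sequentially\<close> decides every predicate
  \<open>P\<close>: if the negation of \<open>P\<close> does not hold eventually, then restricting the filter to \<open>P\<close> keeps it
  proper, hence does not change it.\<close>
lemma exists_free_ultrafilter:
  "\<exists>U \<le> sequentially. U \<noteq> bot \<and> (\<forall>P. eventually P U \<or> (\<forall>\<^sub>F n in U. \<not> P n))"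
proof -
  define A where "A = {F :: nat filter. F \<noteq> bot \<and> F \<le> sequentially}"
  have "\<exists>m\<in>A. \<forall>a\<in>A. m \<ge> a \<longrightarrow> a = m"
  proof (rule predicate_Zorn)
    show "partial_order_on A (relation_of (\<ge>) A)"
      by (rule partial_order_on_relation_ofI) auto
    fix C assume C: "C \<in> Chains (relation_of (\<ge>) A)"
    show "\<exists>u\<in>A. \<forall>a\<in>C. u \<le> a"
    proof (cases "C = {}")
      case True
      then show ?thesis by (auto simp: A_def intro!: exI[of _ sequentially])
    next
      case False
      have CA: "C \<subseteq> A" and total: "\<And>F G. F \<in> C \<Longrightarrow> G \<in> C \<Longrightarrow> F \<le> G \<or> G \<le> F"
        using C by (auto simp: Chains_def relation_of_def)
      have "eventually P (Inf C) \<longleftrightarrow> (\<exists>F\<in>C. eventually P F)" for P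
        using False total by (intro eventually_Inf_base) (auto intro: le_infI)
      then have "Inf C \<noteq> bot"
        using CA by (auto simp: A_def trivial_limit_def)
      moreover have "Inf C \<le> sequentially"
        using False CA by (auto simp: A_def intro: Inf_lower2)
      ultimately show ?thesis
        by (auto simp: A_def intro!: bexI[of _ "Inf C"] Inf_lower)
    qed
  qed
  then obtain U where "U \<in> A" and min: "\<forall>F\<in>A. F \<le> U \<longrightarrow> F = U"
    by blast
  then have U: "U \<noteq> bot" "U \<le> sequentially"
    by (simp_all add: A_def)
  have least: "F = U" if "F \<noteq> bot" "F \<le> U" for F
    using min that order_trans[OF that(2) U(2)] by (simp add: A_def)
  have "eventually P U \<or> (\<forall>\<^sub>F n in U. \<not> P n)" for P
  proof (rule disjCI)
    assume "\<not> (\<forall>\<^sub>F n in U. \<not> P n)"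
    then have "inf U (principal {n. P n}) \<noteq> bot"
      by (simp add: trivial_limit_def eventually_inf_principal)
    then have U: "inf U (principal {n. P n}) = U"
      by (rule least) simp
    have "eventually P (inf U (principal {n. P n}))"
      by (simp add: eventually_inf_principal)
    then show "eventually P U"
      by (simp only: U)
  qed
  with U show ?thesis by blast
qed

text \<open>One ultrafilter is fixed once and for all because the ultrapower of a field, formed below as a type,
  cannot depend on a parameter.\<close>
definition free_ultrafilter :: "nat filter" where
  "free_ultrafilter = (SOME U. U \<le> sequentially \<and> U \<noteq> bot \<and>
     (\<forall>P. eventually P U \<or> (\<forall>\<^sub>F n in U. \<not> P n)))"

lemma
  shows free_ultrafilter_le: "free_ultrafilter \<le> sequentially"
    and free_ultrafilter_neq_bot [simp]: "free_ultrafilter \<noteq> bot"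
    and free_ultrafilter_ultra: "eventually P free_ultrafilter \<or> (\<forall>\<^sub>F n in free_ultrafilter. \<not> P n)"
  using someI_ex[OF exists_free_ultrafilter] unfolding free_ultrafilter_def by blast+

lemma eventually_not_free_ultrafilter [simp]:
  "(\<forall>\<^sub>F n in free_ultrafilter. \<not> P n) \<longleftrightarrow> \<not> eventually P free_ultrafilter"
proof
  assume "\<forall>\<^sub>F n in free_ultrafilter. \<not> P n"
  then show "\<not> eventually P free_ultrafilter"
    using eventually_conj[of P free_ultrafilter "\<lambda>n. \<not> P n"] by auto
qed (use free_ultrafilter_ultra in blast)

lemma eventually_free_ultrafilterI: "eventually P sequentially \<Longrightarrow> eventually P free_ultrafilter"
  using free_ultrafilter_le filter_leD by blast

lemma convergent_free_ultrafilter: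
  fixes f :: "nat \<Rightarrow> real"
  assumes "\<And>n. f n \<in> {a..b}"
  shows "\<exists>l. (f \<longlongrightarrow> l) free_ultrafilter"
proof -
  let ?F = "filtermap f free_ultrafilter"
  have "?F \<noteq> bot" "?F \<le> principal {a..b}"
    using assms by (auto simp: filtermap_bot_iff le_principal eventually_filtermap)
  then obtain l where l: "inf (nhds l) ?F \<noteq> bot"
    using compact_Icc[of a b] unfolding compact_filter le_principal by blast
  have "\<forall>\<^sub>F n in free_ultrafilter. f n \<in> S" if "open S" "l \<in> S" for S
  proof (rule ccontr)
    assume "\<not> ?thesis"
    then have "\<forall>\<^sub>F n in free_ultrafilter. f n \<notin> S" by simp
    then have "\<forall>\<^sub>F x in inf (nhds l) ?F. False"
      unfolding eventually_inf eventually_filtermap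
      using that eventually_nhds_in_open[OF that]
      by (intro exI[of _ "\<lambda>y. y \<in> S"] exI[of _ "\<lambda>y. y \<notin> S"]) auto
    with l show False by (simp add: trivial_limit_def)
  qed
  then have "(f \<longlongrightarrow> l) free_ultrafilter"
    by (rule topological_tendstoI)
  then show ?thesis ..
qed

section \<open>Countable elementary subgroups of ultrapowers\<close>

instance gterm :: countable by countable_datatype
instance gformula :: countable by countable_datatype

text \<open>The Skolem hull of countably many parameters is the set of values of these terms. This makes its
  countability immediate. \<open>Skolem p i ts\<close> stands for a witness of the existential quantifier over
  the variable \<open>i\<close> in front of \<open>p\<close>, where the terms \<open>ts\<close> are the values of the variables
  \<open>0, \<dots>, length ts - 1\<close>.\<close>
datatype skolem_term = Param nat | Skolem gformula nat "skolem_term list"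

instance skolem_term :: countable by countable_datatype

definition skolem_witness ::
  "('g, 'r) monoid_scheme \<Rightarrow> gformula \<Rightarrow> nat \<Rightarrow> (nat \<Rightarrow> 'g) \<Rightarrow> 'g" where
  "skolem_witness G p i v = (SOME x. x \<in> carrier G \<and>
     ((\<exists>y\<in>carrier G. sat G (v(i := y)) p) \<longrightarrow> sat G (v(i := x)) p))"

lemma skolem_witness:
  assumes "carrier G \<noteq> {}"
  shows "skolem_witness G p i v \<in> carrier G"
    and "y \<in> carrier G \<Longrightarrow> sat G (v(i := y)) p \<Longrightarrow> sat G (v(i := skolem_witness G p i v)) p"
proof -
  have "\<exists>x. x \<in> carrier G \<and> ((\<exists>y\<in>carrier G. sat G (v(i := y)) p) \<longrightarrow> sat G (v(i := x)) p)"
    using assms by blast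
  from someI_ex[OF this] show "skolem_witness G p i v \<in> carrier G"
    and "y \<in> carrier G \<Longrightarrow> sat G (v(i := y)) p \<Longrightarrow> sat G (v(i := skolem_witness G p i v)) p"
    unfolding skolem_witness_def by blast+
qed

text \<open>Terms are evaluated in the full power \<open>nat \<Rightarrow> 'g\<close>, with witnesses chosen separately at each index.
  Variables beyond the given list get the default value \<open>\<one>\<close>.\<close>
primrec skolem_seq ::
  "('g, 'r) monoid_scheme \<Rightarrow> (nat \<Rightarrow> nat \<Rightarrow> 'g) \<Rightarrow> skolem_term \<Rightarrow> nat \<Rightarrow> 'g" where
  "skolem_seq G s (Param j) = s j"
| "skolem_seq G s (Skolem p i ts) =
     (\<lambda>n. skolem_witness G p i (nth_default \<one>\<^bsub>G\<^esub> (map (\<lambda>f. f n) (map (skolem_seq G s) ts))))"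

lemma finite_free_vars: "finite (free_vars p)"
proof -
  have "finite (gterm_vars t)" for t by (induction t) auto
  then show ?thesis by (induction p) auto
qed

text \<open>A version of the downward Loewenheim-Skolem theorem for powers: the witnesses for all existential
  formulas can be chosen inside one countable set of sequences. An assignment involves infinitely many
  sequences, but only those for the free variables matter, so that a list of terms suffices.\<close>
lemma countable_skolem_closure:
  fixes G (structure) and s :: "nat \<Rightarrow> nat \<Rightarrow> 'g"
  assumes "carrier G \<noteq> {}" and s: "\<And>j n. s j n \<in> carrier G"
  obtains C where "countable C" "range s \<subseteq> C" "C \<subseteq> UNIV \<rightarrow> carrier G"
    and "\<And>p i v. (\<And>j. v j \<in> C) \<Longrightarrow> \<exists>c\<in>C. \<forall>n. (\<exists>x\<in>carrier G. sat G ((\<lambda>j. v j n)(i := x)) p)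
          \<longrightarrow> sat G ((\<lambda>j. v j n)(i := c n)) p"
proof
  let ?C = "range (skolem_seq G s)"
  show "countable ?C" by blast
  show "range s \<subseteq> ?C"
    by (metis image_subsetI rangeI skolem_seq.simps(1))
  have "skolem_seq G s t n \<in> carrier G" for t n
    by (cases t) (simp_all add: s skolem_witness(1)[OF assms(1)])
  then show "?C \<subseteq> UNIV \<rightarrow> carrier G" by auto
  fix p i and v :: "nat \<Rightarrow> nat \<Rightarrow> 'g" assume "\<And>j. v j \<in> ?C"
  then have "\<forall>j. \<exists>t. v j = skolem_seq G s t" by blast
  then obtain \<tau> where v: "\<And>j. v j = skolem_seq G s (\<tau> j)" by metis
  obtain N where N: "free_vars p \<subseteq> {..<N}"
    using finite_nat_bounded finite_free_vars by blast
  let ?c = "skolem_seq G s (Skolem p i (map \<tau> [0..<N]))"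
  have "sat G ((\<lambda>j. v j n)(i := ?c n)) p"
    if x: "x \<in> carrier G" "sat G ((\<lambda>j. v j n)(i := x)) p" for n x
  proof -
    define w where "w = nth_default \<one> (map (\<lambda>f. f n) (map (skolem_seq G s) (map \<tau> [0..<N])))"
    have w: "w j = v j n" if "j \<in> free_vars p" for j
    proof -
      have "j < N" using that N by auto
      then show ?thesis by (simp add: w_def v nth_default_def)
    qed
    have "sat G (w(i := y)) p \<longleftrightarrow> sat G ((\<lambda>j. v j n)(i := y)) p" for y
      using w by (intro sat_cong) auto
    moreover have "?c n = skolem_witness G p i w" by (simp add: w_def)
    ultimately show ?thesis
      using skolem_witness(2)[OF assms(1), of x w i p] x by simp
  qed
  then show "\<exists>c\<in>?C. \<forall>n. (\<exists>x\<in>carrier G. sat G ((\<lambda>j. v j n)(i := x)) p)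
      \<longrightarrow> sat G ((\<lambda>j. v j n)(i := c n)) p"
    by blast
qed

text \<open>The group \<open>H\<close> is the quotient of a Skolem hull by equality almost everywhere, and \<open>\<rho>\<close> chooses a
  sequence in each class. By induction on formulas, a formula holds in \<open>H\<close> if and only if it holds in
  \<open>G\<close> at almost all indices; the Skolem closure takes care of the existential quantifier, the
  ultrafilter property of the negation.\<close>
theorem countable_elementary_subgroup_of_ultrapower:
  fixes G (structure) and s :: "nat \<Rightarrow> nat \<Rightarrow> 'g"
  assumes "group G" and s: "\<And>j n. s j n \<in> carrier G"
  obtains H :: "nat monoid" and \<rho> :: "nat \<Rightarrow> nat \<Rightarrow> 'g" where
    "group H" "elementarily_equivalent G H"
    "\<And>x n. x \<in> carrier H \<Longrightarrow> \<rho> x n \<in> carrier G"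
    "\<And>x y. x \<in> carrier H \<Longrightarrow> y \<in> carrier H \<Longrightarrow>
       \<forall>\<^sub>F n in free_ultrafilter. \<rho> x n = \<rho> y n \<Longrightarrow> x = y"
    "\<And>x y. x \<in> carrier H \<Longrightarrow> y \<in> carrier H \<Longrightarrow>
       \<forall>\<^sub>F n in free_ultrafilter. \<rho> (x \<otimes>\<^bsub>H\<^esub> y) n = \<rho> x n \<otimes> \<rho> y n"
    "\<And>j. \<exists>x\<in>carrier H. \<forall>\<^sub>F n in free_ultrafilter. \<rho> x n = s j n"
proof -
  interpret group G by fact
  have "carrier G \<noteq> {}" by auto
  from countable_skolem_closure[of G s, OF this s] obtain C where
    C: "countable C" "range s \<subseteq> C" "C \<subseteq> UNIV \<rightarrow> carrier G"
    and wit: "\<And>p i v. (\<And>j. v j \<in> C) \<Longrightarrow> \<exists>c\<in>C. \<forall>n. (\<exists>x\<in>carrier G. sat G ((\<lambda>j. v j n)(i := x)) p)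
          \<longrightarrow> sat G ((\<lambda>j. v j n)(i := c n)) p"
    by metis
  have "C \<noteq> {}" using C(2) by auto
  define \<rho> where "\<rho> = from_nat_into C"
  \<comment> \<open>The code of a class is the least index at which the enumeration \<open>\<rho>\<close> of \<open>C\<close> meets it.\<close>
  define cls where "cls f = (LEAST m. \<forall>\<^sub>F n in free_ultrafilter. \<rho> m n = f n)" for f
  define H where "H = \<lparr> carrier = cls ` C,
     monoid.mult = \<lambda>x y. SOME z. z \<in> cls ` C \<and> (\<forall>\<^sub>F n in free_ultrafilter. \<rho> z n = \<rho> x n \<otimes> \<rho> y n),
     monoid.one = SOME z. z \<in> cls ` C \<and> (\<forall>\<^sub>F n in free_ultrafilter. \<rho> z n = \<one>) \<rparr>"
  have carrier_H: "carrier H = cls ` C" by (simp add: H_def)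
  have \<rho>C: "\<rho> m \<in> C" for m
    unfolding \<rho>_def using \<open>C \<noteq> {}\<close> by (rule from_nat_into)
  then have \<rho>G [simp]: "\<rho> m n \<in> carrier G" for m n
    using C(3) by blast
  have \<rho>_cls: "\<forall>\<^sub>F n in free_ultrafilter. \<rho> (cls f) n = f n" if f: "f \<in> C" for f
    unfolding cls_def
  proof (rule LeastI_ex)
    obtain m where "\<rho> m = f"
      using from_nat_into_surj[OF C(1) f] unfolding \<rho>_def by blast
    then show "\<exists>m. \<forall>\<^sub>F n in free_ultrafilter. \<rho> m n = f n"
      by (intro exI[of _ m]) simp
  qed
  have cls_cong: "cls f = cls g" if "\<forall>\<^sub>F n in free_ultrafilter. f n = g n" for f g
  proof -
    have "(\<forall>\<^sub>F n in free_ultrafilter. \<rho> m n = f n) \<longleftrightarrow> (\<forall>\<^sub>F n in free_ultrafilter. \<rho> m n = g n)" for m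
      using that by (intro eventually_subst) (auto elim: eventually_mono)
    then show ?thesis by (simp add: cls_def)
  qed
  have cls_\<rho>: "cls (\<rho> x) = x" if "x \<in> carrier H" for x
    using that \<rho>_cls cls_cong unfolding carrier_H by blast
  have eqI: "x = y" if "x \<in> carrier H" "y \<in> carrier H" "\<forall>\<^sub>F n in free_ultrafilter. \<rho> x n = \<rho> y n" for x y
    using cls_cong[OF that(3)] cls_\<rho> that by simp
  \<comment> \<open>The group operations of \<^term>\<open>G\<close> are Skolem functions of the formulas \<open>v\<^sub>0 = t\<close>.\<close>
  have term_closed: "\<exists>z. z \<in> cls ` C \<and> (\<forall>\<^sub>F n in free_ultrafilter. \<rho> z n = gterm_val G (\<lambda>j. v j n) t)"
    if v: "\<And>j. v j \<in> C" and t: "0 \<notin> gterm_vars t" "\<And>n. gterm_val G (\<lambda>j. v j n) t \<in> carrier G" for v t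
  proof -
    obtain c where c: "c \<in> C" "\<And>n x. x \<in> carrier G \<Longrightarrow> sat G ((\<lambda>j. v j n)(0 := x)) (Eq (Var 0) t)
        \<Longrightarrow> sat G ((\<lambda>j. v j n)(0 := c n)) (Eq (Var 0) t)"
      using wit[of v 0 "Eq (Var 0) t", OF v] by blast
    have "gterm_val G ((\<lambda>j. v j n)(0 := x)) t = gterm_val G (\<lambda>j. v j n) t" for n x
      using t(1) by (intro gterm_val_cong) auto
    then have "c n = gterm_val G (\<lambda>j. v j n) t" for n
      using c(2)[OF t(2)[of n], of n] by simp
    then show ?thesis
      using \<rho>_cls[OF c(1)] c(1) by auto
  qed
  have mult: "x \<otimes>\<^bsub>H\<^esub> y \<in> carrier H \<and> (\<forall>\<^sub>F n in free_ultrafilter. \<rho> (x \<otimes>\<^bsub>H\<^esub> y) n = \<rho> x n \<otimes> \<rho> y n)" for x y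
  proof -
    have "\<exists>z. z \<in> cls ` C \<and> (\<forall>\<^sub>F n in free_ultrafilter. \<rho> z n = \<rho> x n \<otimes> \<rho> y n)"
      using term_closed[of "\<lambda>j. if j = 1 then \<rho> x else \<rho> y" "Mult (Var 1) (Var 2)"] by (simp add: \<rho>C)
    from someI_ex[OF this] show ?thesis by (simp add: H_def)
  qed
  have one: "\<one>\<^bsub>H\<^esub> \<in> carrier H \<and> (\<forall>\<^sub>F n in free_ultrafilter. \<rho> (\<one>\<^bsub>H\<^esub>) n = \<one>)"
  proof -
    have "\<exists>z. z \<in> cls ` C \<and> (\<forall>\<^sub>F n in free_ultrafilter. \<rho> z n = \<one>)"
      using term_closed[of "\<lambda>j. \<rho> 0" "Unit"] by (simp add: \<rho>C)
    from someI_ex[OF this] show ?thesis by (simp add: H_def)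
  qed
  have ex_inv: "\<exists>z. z \<in> carrier H \<and> (\<forall>\<^sub>F n in free_ultrafilter. \<rho> z n = inv (\<rho> x n))" for x
    using term_closed[of "\<lambda>j. \<rho> x" "Inv (Var 1)"] by (simp add: \<rho>C carrier_H)
  have "group H"
  proof (rule groupI)
    fix x y z assume "x \<in> carrier H" "y \<in> carrier H" "z \<in> carrier H"
    have "\<forall>\<^sub>F n in free_ultrafilter. \<rho> (x \<otimes>\<^bsub>H\<^esub> y \<otimes>\<^bsub>H\<^esub> z) n = \<rho> (x \<otimes>\<^bsub>H\<^esub> (y \<otimes>\<^bsub>H\<^esub> z)) n"
      using mult[of x y, THEN conjunct2] mult[of "x \<otimes>\<^bsub>H\<^esub> y" z, THEN conjunct2]
        mult[of y z, THEN conjunct2] mult[of x "y \<otimes>\<^bsub>H\<^esub> z", THEN conjunct2]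
      by eventually_elim (simp add: m_assoc)
    then show "x \<otimes>\<^bsub>H\<^esub> y \<otimes>\<^bsub>H\<^esub> z = x \<otimes>\<^bsub>H\<^esub> (y \<otimes>\<^bsub>H\<^esub> z)"
      using mult by (intro eqI) auto
  next
    fix x assume x: "x \<in> carrier H"
    have "\<forall>\<^sub>F n in free_ultrafilter. \<rho> (\<one>\<^bsub>H\<^esub> \<otimes>\<^bsub>H\<^esub> x) n = \<rho> x n"
      using mult[of "\<one>\<^bsub>H\<^esub>" x, THEN conjunct2] one[THEN conjunct2]
      by eventually_elim simp
    then show "\<one>\<^bsub>H\<^esub> \<otimes>\<^bsub>H\<^esub> x = x"
      using mult x by (intro eqI) auto
    obtain y where y: "y \<in> carrier H" "\<forall>\<^sub>F n in free_ultrafilter. \<rho> y n = inv (\<rho> x n)"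
      using ex_inv by blast
    have "\<forall>\<^sub>F n in free_ultrafilter. \<rho> (y \<otimes>\<^bsub>H\<^esub> x) n = \<rho> \<one>\<^bsub>H\<^esub> n"
      using mult[of y x, THEN conjunct2] one[THEN conjunct2] y(2)
      by eventually_elim simp
    then have "y \<otimes>\<^bsub>H\<^esub> x = \<one>\<^bsub>H\<^esub>"
      using mult one by (intro eqI) auto
    with y show "\<exists>y\<in>carrier H. y \<otimes>\<^bsub>H\<^esub> x = \<one>\<^bsub>H\<^esub>" by blast
  qed (use mult one in auto)
  then interpret H: group H .
  have inv: "\<forall>\<^sub>F n in free_ultrafilter. \<rho> (inv\<^bsub>H\<^esub> x) n = inv (\<rho> x n)" if x: "x \<in> carrier H" for x
  proof -
    have "\<forall>\<^sub>F n in free_ultrafilter. \<rho> (inv\<^bsub>H\<^esub> x) n \<otimes> \<rho> x n = \<one>"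
      using mult[of "inv\<^bsub>H\<^esub> x" x, THEN conjunct2] one[THEN conjunct2]
      by eventually_elim (simp add: x)
    then show ?thesis
      by eventually_elim (simp add: inv_equality)
  qed
  have gterm_val: "gterm_val H v t \<in> carrier H \<and>
      (\<forall>\<^sub>F n in free_ultrafilter. \<rho> (gterm_val H v t) n = gterm_val G (\<lambda>j. \<rho> (v j) n) t)"
    if v: "\<And>j. v j \<in> carrier H" for v t
  proof (induction t)
    case (Mult t1 t2)
    have "\<forall>\<^sub>F n in free_ultrafilter. \<rho> (gterm_val H v (Mult t1 t2)) n = gterm_val G (\<lambda>j. \<rho> (v j) n) (Mult t1 t2)"
      using Mult[THEN conjunct2] mult[of "gterm_val H v t1" "gterm_val H v t2", THEN conjunct2]
      by eventually_elim simp
    then show ?case using mult by simp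
  next
    case (Inv t)
    have "\<forall>\<^sub>F n in free_ultrafilter. \<rho> (gterm_val H v (Inv t)) n = gterm_val G (\<lambda>j. \<rho> (v j) n) (Inv t)"
      using Inv[THEN conjunct2] inv[OF Inv[THEN conjunct1]]
      by eventually_elim simp
    then show ?case using Inv by simp
  qed (use v one in auto)
  have los: "sat H v p \<longleftrightarrow> (\<forall>\<^sub>F n in free_ultrafilter. sat G (\<lambda>j. \<rho> (v j) n) p)"
    if v: "\<And>j. v j \<in> carrier H" for v p
    using v
  proof (induction p arbitrary: v)
    case (Eq t1 t2)
    have 1: "\<forall>\<^sub>F n in free_ultrafilter. (\<rho> (gterm_val H v t1) n = \<rho> (gterm_val H v t2) n)
        = sat G (\<lambda>j. \<rho> (v j) n) (Eq t1 t2)"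
      using gterm_val[of v t1, OF Eq, THEN conjunct2] gterm_val[of v t2, OF Eq, THEN conjunct2]
      by eventually_elim simp
    have "sat H v (Eq t1 t2) \<longleftrightarrow> (\<forall>\<^sub>F n in free_ultrafilter. \<rho> (gterm_val H v t1) n = \<rho> (gterm_val H v t2) n)"
      using gterm_val[OF Eq] eqI by auto
    also have "\<dots> \<longleftrightarrow> (\<forall>\<^sub>F n in free_ultrafilter. sat G (\<lambda>j. \<rho> (v j) n) (Eq t1 t2))"
      using 1 by (rule eventually_subst)
    finally show ?case .
  next
    case (Exists i p)
    have upd: "(\<lambda>j. \<rho> ((v(i := x)) j) n) = (\<lambda>j. \<rho> (v j) n)(i := \<rho> x n)" for x n
      by auto
    have IH: "sat H (v(i := x)) p \<longleftrightarrow>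
        (\<forall>\<^sub>F n in free_ultrafilter. sat G ((\<lambda>j. \<rho> (v j) n)(i := \<rho> x n)) p)" if x: "x \<in> carrier H" for x
    proof -
      have "(v(i := x)) j \<in> carrier H" for j
        using x Exists.prems by simp
      from Exists.IH[of "v(i := x)", OF this] show ?thesis
        unfolding upd .
    qed
    show ?case
    proof
      assume "sat H v (Exists i p)"
      then obtain x where "x \<in> carrier H" "sat H (v(i := x)) p" by auto
      then have "\<forall>\<^sub>F n in free_ultrafilter. sat G ((\<lambda>j. \<rho> (v j) n)(i := \<rho> x n)) p"
        using IH by blast
      then show "\<forall>\<^sub>F n in free_ultrafilter. sat G (\<lambda>j. \<rho> (v j) n) (Exists i p)"
        by eventually_elim auto
    next
      assume *: "\<forall>\<^sub>F n in free_ultrafilter. sat G (\<lambda>j. \<rho> (v j) n) (Exists i p)"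
      obtain c where c: "c \<in> C" "\<forall>n. (\<exists>x\<in>carrier G. sat G ((\<lambda>j. \<rho> (v j) n)(i := x)) p)
          \<longrightarrow> sat G ((\<lambda>j. \<rho> (v j) n)(i := c n)) p"
        using wit[of "\<lambda>j. \<rho> (v j)" i p] \<rho>C by blast
      have "\<forall>\<^sub>F n in free_ultrafilter. sat G ((\<lambda>j. \<rho> (v j) n)(i := \<rho> (cls c) n)) p"
        using * \<rho>_cls[OF c(1)] by eventually_elim (use c(2) in auto)
      then have "sat H (v(i := cls c)) p"
        using IH c(1) carrier_H by blast
      then show "sat H v (Exists i p)"
        using c(1) carrier_H by auto
    qed
  qed (simp_all add: eventually_conj_iff)
  have "elementarily_equivalent G H"
    unfolding elementarily_equivalent_def
  proof (intro allI impI)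
    fix p assume p: "sentence p"
    let ?v = "\<lambda>_::nat. \<one>\<^bsub>H\<^esub>"
    have "satisfies H p \<longleftrightarrow> sat H ?v p"
      using p by (rule satisfies_iff) auto
    also have "\<dots> \<longleftrightarrow> (\<forall>\<^sub>F n in free_ultrafilter. sat G (\<lambda>j. \<rho> (?v j) n) p)"
      by (rule los) simp
    also have "\<dots> \<longleftrightarrow> (\<forall>\<^sub>F n in free_ultrafilter. satisfies G p)"
      using satisfies_iff[OF p, of "\<lambda>j. \<rho> (?v j) n" G for n] by simp
    finally show "satisfies G p \<longleftrightarrow> satisfies H p"
      by (simp add: eventually_const_iff)
  qed
  moreover have "\<exists>x\<in>carrier H. \<forall>\<^sub>F n in free_ultrafilter. \<rho> x n = s j n" for j
    using \<rho>_cls[of "s j"] C(2) carrier_H by blast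
  ultimately show thesis
    using that \<open>group H\<close> \<rho>G eqI mult by blast
qed

section \<open>Invariant means\<close>

lemma fin_additive_probD:
  assumes m: "fin_additive_prob E m"
  shows "A \<subseteq> E \<Longrightarrow> B \<subseteq> E \<Longrightarrow> A \<inter> B = {} \<Longrightarrow> m (A \<union> B) = m A + m B"
    and "A \<subseteq> B \<Longrightarrow> B \<subseteq> E \<Longrightarrow> m A \<le> m B"
    and "A \<subseteq> E \<Longrightarrow> B \<subseteq> E \<Longrightarrow> m A + m B = m (A \<union> B) + m (A \<inter> B)"
    and "A \<subseteq> E \<Longrightarrow> m (E - A) = 1 - m A"
    and "A \<subseteq> E \<Longrightarrow> 0 \<le> m A" "A \<subseteq> E \<Longrightarrow> m A \<le> 1"
proof -
  show nonneg: "A \<subseteq> E \<Longrightarrow> 0 \<le> m A" for A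
    using m by (simp add: fin_additive_prob_def)
  have add: "m (A \<union> B) = m A + m B" if "A \<subseteq> E" "B \<subseteq> E" "A \<inter> B = {}" for A B
    using m that unfolding fin_additive_prob_def additive_def by blast
  then show "A \<subseteq> E \<Longrightarrow> B \<subseteq> E \<Longrightarrow> A \<inter> B = {} \<Longrightarrow> m (A \<union> B) = m A + m B" .
  have diff: "m (B - A) = m B - m A" if "A \<subseteq> B" "B \<subseteq> E" for A B
  proof -
    have "m (A \<union> (B - A)) = m A + m (B - A)"
      using that by (intro add) auto
    then show ?thesis using that by (simp add: Un_absorb1)
  qed
  show mono: "m A \<le> m B" if "A \<subseteq> B" "B \<subseteq> E" for A B
    using diff[OF that] nonneg[of "B - A"] that by auto
  have "m E = 1" using m by (simp add: fin_additive_prob_def)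
  then show "A \<subseteq> E \<Longrightarrow> m (E - A) = 1 - m A" "A \<subseteq> E \<Longrightarrow> m A \<le> 1"
    using diff[of A E] mono[of A E] by auto
  show "m A + m B = m (A \<union> B) + m (A \<inter> B)" if "A \<subseteq> E" "B \<subseteq> E"
  proof -
    have "m (A \<union> B) = m A + m (B - A)"
      using add[of A "B - A"] that by (simp add: Un_absorb1 subset_iff)
    moreover have "m (B - A) = m B - m (A \<inter> B)"
      using diff[of "A \<inter> B" B] that by (simp add: Diff_Int2 Diff_Int)
    ultimately show ?thesis by simp
  qed
qed

lemma fin_additive_prob_uniform:
  assumes "finite F" "F \<noteq> {}" "F \<subseteq> E"
  shows "fin_additive_prob E (\<lambda>A. card (A \<inter> F) / card F)"
  unfolding fin_additive_prob_def additive_def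
proof (intro conjI ballI impI)
  have "card F > 0" using assms by (simp add: card_gt_0_iff)
  then show "card (E \<inter> F) / card F = 1"
    using assms(3) by (simp add: Int_absorb1)
  fix A B :: "'a set" assume "A \<inter> B = {}"
  then have "card ((A \<union> B) \<inter> F) = card (A \<inter> F) + card (B \<inter> F)"
    unfolding Int_Un_distrib2 using assms(1) by (intro card_Un_disjoint) auto
  then show "card ((A \<union> B) \<inter> F) / card F = card (A \<inter> F) / card F + card (B \<inter> F) / card F"
    by (simp add: add_divide_distrib)
qed simp

lemma card_image_Int_invariant:
  assumes "inj_on f E" "A \<subseteq> E" "F \<subseteq> E" "finite F" "f ` F \<subseteq> F"
  shows "card (f ` A \<inter> F) = card (A \<inter> F)"
proof -
  have "f ` F = F"
    using assms by (meson endo_inj_surj inj_on_subset)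
  then have "f ` A \<inter> F = f ` (A \<inter> F)"
    using inj_on_image_Int[OF assms(1-3)] by simp
  moreover have "inj_on f (A \<inter> F)"
    using assms by (meson inf.coboundedI1 inj_on_subset)
  ultimately show ?thesis by (simp add: card_image)
qed

text \<open>The uniform measures on the finite sets \<open>F n\<close> are eventually invariant under each group element,
  so their ultralimit is invariant. If the \<open>F n\<close> are an increasing chain of finite subgroups with
  union \<open>G\<close>, the hypotheses hold.\<close>
theorem amenable_group_locally_finite:
  fixes G (structure)
  assumes "group G"
    and F: "\<And>n. finite (F n)" "\<And>n. F n \<noteq> {}" "\<And>n. F n \<subseteq> carrier G"
    and invariant: "\<And>g. g \<in> carrier G \<Longrightarrow> \<forall>\<^sub>F n in sequentially. \<forall>x\<in>F n. g \<otimes> x \<in> F n"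
  shows "amenable_group G"
proof -
  interpret group G by fact
  define \<mu> where "\<mu> n A = card (A \<inter> F n) / card (F n)" for n A
  have \<mu>: "fin_additive_prob (carrier G) (\<mu> n)" for n
    using fin_additive_prob_uniform[OF F(1-3)[of n]] by (simp add: \<mu>_def[abs_def])
  define m where "m A = Lim free_ultrafilter (\<lambda>n. \<mu> n A)" for A
  have lim: "((\<lambda>n. \<mu> n A) \<longlongrightarrow> m A) free_ultrafilter" if A: "A \<subseteq> carrier G" for A
  proof -
    have "\<mu> n A \<in> {0..1}" for n
      using fin_additive_probD(5,6)[OF \<mu> A] by simp
    then obtain l where l: "((\<lambda>n. \<mu> n A) \<longlongrightarrow> l) free_ultrafilter"
      using convergent_free_ultrafilter[of "\<lambda>n. \<mu> n A" 0 1] by auto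
    then show ?thesis
      by (simp add: m_def tendsto_Lim[OF free_ultrafilter_neq_bot l])
  qed
  have "fin_additive_prob (carrier G) m"
    unfolding fin_additive_prob_def additive_def
  proof (intro conjI ballI impI)
    fix A assume "A \<in> Pow (carrier G)"
    then show "0 \<le> m A"
      using fin_additive_probD(5)[OF \<mu>] tendsto_lowerbound[OF lim] by simp
  next
    fix A B assume A: "A \<in> Pow (carrier G)" and B: "B \<in> Pow (carrier G)" and AB: "A \<inter> B = {}"
    have "\<mu> n (A \<union> B) = \<mu> n A + \<mu> n B" for n
      using fin_additive_probD(1)[OF \<mu>] A B AB by simp
    then have "((\<lambda>n. \<mu> n A + \<mu> n B) \<longlongrightarrow> m (A \<union> B)) free_ultrafilter"
      using lim[of "A \<union> B"] A B by simp
    moreover have "((\<lambda>n. \<mu> n A + \<mu> n B) \<longlongrightarrow> m A + m B) free_ultrafilter"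
      using A B by (intro tendsto_add lim) auto
    ultimately show "m (A \<union> B) = m A + m B"
      by (rule tendsto_unique[OF free_ultrafilter_neq_bot])
  next
    have "\<mu> n (carrier G) = 1" for n
      using \<mu>[of n] by (simp add: fin_additive_prob_def)
    then have "((\<lambda>n. 1) \<longlongrightarrow> m (carrier G)) free_ultrafilter"
      using lim[of "carrier G"] by simp
    then show "m (carrier G) = 1"
      by (simp add: tendsto_const_iff)
  qed
  moreover have "m (left_mult G g ` A) = m A" if g: "g \<in> carrier G" and A: "A \<subseteq> carrier G" for g A
  proof -
    interpret act: group_action G "carrier G" "left_mult G"
      by (rule group_action_left_mult)
    have gA: "left_mult G g ` A \<subseteq> carrier G"
      using act.surj_prop[OF g] A by blast
    have "\<forall>\<^sub>F n in free_ultrafilter. \<mu> n (left_mult G g ` A) = \<mu> n A"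
      using eventually_free_ultrafilterI[OF invariant[OF g]]
    proof eventually_elim
      case (elim n)
      then have "left_mult G g ` F n \<subseteq> F n"
        using F(3)[of n] by (auto simp: left_mult_def)
      then show ?case
        using card_image_Int_invariant[OF act.inj_prop[OF g] A F(3) F(1)] by (simp add: \<mu>_def)
    qed
    then have "((\<lambda>n. \<mu> n A) \<longlongrightarrow> m (left_mult G g ` A)) free_ultrafilter"
      using lim[OF gA] by (rule Lim_transform_eventually[rotated])
    then show ?thesis
      using lim[OF A] by (rule tendsto_unique[OF free_ultrafilter_neq_bot])
  qed
  ultimately show ?thesis
    unfolding amenable_group_def amenable_action_def by blast
qed

text \<open>The uniform measure on the orbit is an invariant mean.\<close>
lemma amenable_action_finite_orbit:
  assumes "group_action G E \<phi>" and x: "x \<in> E" and fin: "finite (orbit G \<phi> x)"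
  shows "amenable_action G E \<phi>"
proof -
  interpret group_action G E \<phi> by fact
  let ?O = "orbit G \<phi> x"
  have O: "?O \<noteq> {}" "?O \<subseteq> E"
    using x orbit_refl element_image by (auto simp: orbit_def)
  have "\<phi> g ` ?O \<subseteq> ?O" if g: "g \<in> carrier G" for g
  proof
    fix y assume "y \<in> \<phi> g ` ?O"
    then obtain h where "h \<in> carrier G" "y = \<phi> g (\<phi> h x)"
      by (auto simp: orbit_def)
    then show "y \<in> ?O"
      using composition_rule[OF x g] group_hom group_hom.axioms(1) g
      by (auto simp: orbit_def intro!: exI[of _ "g \<otimes>\<^bsub>G\<^esub> h"] monoid.m_closed group.is_monoid)
  qed
  then have "card (\<phi> g ` A \<inter> ?O) = card (A \<inter> ?O)" if "g \<in> carrier G" "A \<subseteq> E" for g A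
    using that O by (intro card_image_Int_invariant[OF inj_prop] fin) auto
  then show ?thesis
    unfolding amenable_action_def
    using fin_additive_prob_uniform[OF fin O]
    by (intro exI[of _ "\<lambda>A. card (A \<inter> ?O) / card ?O"]) auto
qed

lemma icc_if_not_inner_amenable:
  assumes "group H" "\<not> inner_amenable H" "carrier H \<noteq> {\<one>\<^bsub>H\<^esub>}"
  shows "icc H"
  unfolding icc_def
proof (intro conjI ballI notI)
  interpret group H by fact
  fix x assume x: "x \<in> nonidentity H" and fin: "finite (orbit H (conjugation H) x)"
  have "orbit H (\<lambda>g. restrict (conjugation H g) (nonidentity H)) x = orbit H (conjugation H) x"
    using x by (auto simp: orbit_def)
  with fin x have "inner_amenable H"
    unfolding inner_amenable_def
    by (intro amenable_action_finite_orbit group_action_conjugation_nonidentity) auto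
  with assms(2) show False by contradiction
qed (use assms in auto)

text \<open>The set \<open>Fix x\<close> is to be thought of as the fixed point set of \<open>x\<close> in a space on which \<open>H\<close> acts
  through \<open>act\<close>. The hypotheses say that \<open>g i\<close> moves the complement of \<open>V i\<close> into \<open>U i\<close>, that the
  \<open>U i\<close> are disjoint and that no fixed point set meets three of the sets \<open>V i\<close>. With
  \<open>A i\<close> the set of those \<open>x\<close> whose fixed point set meets \<open>V i\<close>, and \<open>B i\<close> the set of those whose
  fixed points all lie in \<open>U i\<close>, conjugation by \<open>g i\<close> maps the complement of \<open>A i\<close> into \<open>B i\<close>. The
  total mean of the \<open>A i\<close> is at most 2 and that of the \<open>B i\<close> at most 1, which is too little for four
  indices.\<close>
theorem not_inner_amenable_if_ping_pong:
  fixes H (structure) and U V :: "nat \<Rightarrow> 'p set"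
  assumes "group H"
    and Fix: "\<And>x. x \<in> nonidentity H \<Longrightarrow> Fix x \<noteq> {}"
      "\<And>g x. g \<in> carrier H \<Longrightarrow> x \<in> nonidentity H \<Longrightarrow> Fix (g \<otimes> x \<otimes> inv g) \<subseteq> act g ` Fix x"
    and g: "\<And>i. i < 4 \<Longrightarrow> g i \<in> carrier H"
    and ping_pong: "\<And>i x p. i < 4 \<Longrightarrow> x \<in> nonidentity H \<Longrightarrow> p \<in> Fix x \<Longrightarrow> p \<notin> V i \<Longrightarrow> act (g i) p \<in> U i"
    and disjoint: "\<And>i j x p. i < j \<Longrightarrow> j < 4 \<Longrightarrow> x \<in> nonidentity H \<Longrightarrow> p \<in> Fix x \<Longrightarrow> p \<in> U i \<Longrightarrow> p \<notin> U j"
    and few: "\<And>i j k x p q r. i < j \<Longrightarrow> j < k \<Longrightarrow> k < 4 \<Longrightarrow> x \<in> nonidentity H \<Longrightarrow>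
      p \<in> Fix x \<inter> V i \<Longrightarrow> q \<in> Fix x \<inter> V j \<Longrightarrow> r \<notin> Fix x \<inter> V k"
  shows "\<not> inner_amenable H"
proof
  interpret group H by fact
  let ?E = "nonidentity H"
  let ?\<phi> = "\<lambda>g. restrict (conjugation H g) ?E"
  interpret act: group_action H ?E ?\<phi>
    by (rule group_action_conjugation_nonidentity)
  assume "inner_amenable H"
  then obtain m where m: "fin_additive_prob ?E m"
    and inv: "\<And>g A. g \<in> carrier H \<Longrightarrow> A \<subseteq> ?E \<Longrightarrow> m (?\<phi> g ` A) = m A"
    unfolding inner_amenable_def amenable_action_def by blast
  note prob = fin_additive_probD[OF m]
  define A where "A i = {x \<in> ?E. Fix x \<inter> V i \<noteq> {}}" for i
  define B where "B i = {x \<in> ?E. Fix x \<subseteq> U i}" for i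
  have AX: "A i \<subseteq> ?E" and BX: "B i \<subseteq> ?E" for i
    by (auto simp: A_def B_def)
  have AB: "1 - m (A i) \<le> m (B i)" if i: "i < 4" for i
  proof -
    have "?\<phi> (g i) x \<in> B i" if x: "x \<in> ?E - A i" for x
    proof -
      have "?\<phi> (g i) x \<in> ?E"
        using act.element_image[OF g[OF i] _ refl, of x] x by simp
      moreover have "Fix (?\<phi> (g i) x) \<subseteq> act (g i) ` Fix x"
        using Fix(2)[OF g[OF i]] x by (simp add: conjugation_def nonidentity_def)
      moreover have "act (g i) ` Fix x \<subseteq> U i"
        using ping_pong[OF i] x by (auto simp: A_def)
      ultimately show ?thesis by (auto simp: B_def)
    qed
    then have "m (?\<phi> (g i) ` (?E - A i)) \<le> m (B i)"
      by (intro prob(2) BX) auto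
    moreover have "m (?\<phi> (g i) ` (?E - A i)) = 1 - m (A i)"
      using inv[OF g[OF i], of "?E - A i"] prob(4)[OF AX] by auto
    ultimately show ?thesis by simp
  qed
  have disj: "B i \<inter> B j = {}" if "i < j" "j < 4" for i j
    using disjoint[OF that] Fix(1) by (fastforce simp: B_def)
  have "m (B 0) + m (B 1) + m (B 2) + m (B 3) = m (B 0 \<union> B 1 \<union> B 2 \<union> B 3)"
    using disj[of 0 1] disj[of 0 2] disj[of 0 3] disj[of 1 2] disj[of 1 3] disj[of 2 3] BX
    by (simp add: prob(1) Int_Un_distrib2)
  also have "\<dots> \<le> 1" using BX by (intro prob) auto
  finally have B: "m (B 0) + m (B 1) + m (B 2) + m (B 3) \<le> 1" .
  have triple: "A i \<inter> A j \<inter> A k = {}" if "i < j" "j < k" "k < 4" for i j k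
    using few[OF that] by (fastforce simp: A_def)
  define P where "P i j = A i \<union> A j" for i j
  define Q where "Q i j = A i \<inter> A j" for i j
  have PQ: "P i j \<subseteq> ?E" "Q i j \<subseteq> ?E" for i j
    using AX by (auto simp: P_def Q_def)
  \<comment> \<open>Pairing the four sets turns the bound into disjointness: \<open>P 0 1\<close> and \<open>Q 2 3\<close> share no point, nor do \<open>P 2 3\<close> and \<open>Q 0 1\<close>.\<close>
  have "m (A i) + m (A j) = m (P i j) + m (Q i j)" for i j
    unfolding P_def Q_def by (rule prob(3)[OF AX AX])
  then have "m (A 0) + m (A 1) + m (A 2) + m (A 3) = m (P 0 1) + m (Q 0 1) + (m (P 2 3) + m (Q 2 3))"
    by (simp add: add.assoc)
  also have "\<dots> = m (P 0 1 \<union> Q 2 3) + m (P 2 3 \<union> Q 0 1)"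
  proof -
    have "P 0 1 \<inter> Q 2 3 = {}" "P 2 3 \<inter> Q 0 1 = {}"
      using triple[of 0 2 3] triple[of 1 2 3] triple[of 0 1 2] triple[of 0 1 3]
      by (auto simp: P_def Q_def)
    then show ?thesis
      using PQ by (simp add: prob(1))
  qed
  also have "\<dots> \<le> 1 + 1"
    using PQ by (intro add_mono prob) auto
  finally have A: "m (A 0) + m (A 1) + m (A 2) + m (A 3) \<le> 2" by simp
  from AB[of 0] AB[of 1] AB[of 2] AB[of 3] A B show False by simp
qed

section \<open>Valuation rings\<close>

definition subring_of_field :: "'a::field set \<Rightarrow> bool" where
  "subring_of_field R \<longleftrightarrow> 1 \<in> R \<and> (\<forall>x\<in>R. \<forall>y\<in>R. x - y \<in> R \<and> x * y \<in> R)"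

lemma subring_of_fieldD:
  assumes "subring_of_field R"
  shows "1 \<in> R" "0 \<in> R"
    and "x \<in> R \<Longrightarrow> y \<in> R \<Longrightarrow> x - y \<in> R"
    and "x \<in> R \<Longrightarrow> y \<in> R \<Longrightarrow> x * y \<in> R"
    and "x \<in> R \<Longrightarrow> y \<in> R \<Longrightarrow> x + y \<in> R"
    and "x \<in> R \<Longrightarrow> x ^ n \<in> R"
    and "(\<And>i. i \<in> I \<Longrightarrow> f i \<in> R) \<Longrightarrow> sum f I \<in> R"
proof -
  show 1: "1 \<in> R" and diff: "x \<in> R \<Longrightarrow> y \<in> R \<Longrightarrow> x - y \<in> R"
    and mult: "x \<in> R \<Longrightarrow> y \<in> R \<Longrightarrow> x * y \<in> R" for x y
    using assms by (auto simp: subring_of_field_def)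
  from diff[OF 1 1] show 0: "0 \<in> R" by simp
  show add: "x + y \<in> R" if "x \<in> R" "y \<in> R" for x y
    using diff[OF that(1) diff[OF 0 that(2)]] by simp
  show "x \<in> R \<Longrightarrow> x ^ n \<in> R" by (induction n) (auto intro: 1 mult)
  show "(\<And>i. i \<in> I \<Longrightarrow> f i \<in> R) \<Longrightarrow> sum f I \<in> R"
    by (induction I rule: infinite_finite_induct) (auto intro: 0 add)
qed

text \<open>For a subring \<open>R\<close> this is the ring \<open>R[x]\<close>.\<close>
definition adjoin :: "'a::field set \<Rightarrow> 'a \<Rightarrow> 'a set" where
  "adjoin R x = {poly p x | p. \<forall>i. coeff p i \<in> R}"

lemma adjoin:
  assumes R: "subring_of_field R"
  shows "subring_of_field (adjoin R x)" "R \<subseteq> adjoin R x" "x \<in> adjoin R x"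
proof -
  note [intro] = subring_of_fieldD[OF R]
  have poly: "poly p x \<in> adjoin R x" if "\<And>i. coeff p i \<in> R" for p
    using that by (auto simp: adjoin_def)
  have const: "a \<in> adjoin R x" if "a \<in> R" for a
  proof -
    have "coeff [:a:] i \<in> R" for i
      using that by (cases i) auto
    from poly[OF this] show ?thesis by simp
  qed
  show "subring_of_field (adjoin R x)"
    unfolding subring_of_field_def
  proof (intro conjI ballI)
    show "1 \<in> adjoin R x"
      using const[of 1] by auto
    fix y z assume "y \<in> adjoin R x" "z \<in> adjoin R x"
    then obtain p q where "y = poly p x" "z = poly q x"
      and pq: "\<And>i. coeff p i \<in> R" "\<And>i. coeff q i \<in> R"
      by (auto simp: adjoin_def)
    then show "y - z \<in> adjoin R x" "y * z \<in> adjoin R x"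
      using poly[of "p - q"] poly[of "p * q"] by (auto simp: coeff_mult)
  qed
  show "R \<subseteq> adjoin R x"
    using const by blast
  have "coeff [:0, 1:] i \<in> R" for i
    by (auto simp: coeff_pCons split: nat.splits)
  from poly[OF this] show "x \<in> adjoin R x" by simp
qed

text \<open>Were \<open>c = 1 - tb\<close> not invertible in \<open>S\<close>, then \<open>1/t\<close> would be a polynomial in \<open>1/c\<close> by maximality.
  Clearing denominators puts \<open>c\<^sup>n/t\<close> into \<open>S\<close>. As \<open>c\<^sup>n\<close> is congruent to \<open>1\<close> modulo \<open>t\<close>, also
  \<open>(1 - c\<^sup>n)/t\<close> lies in \<open>S\<close>, and the sum of the two is \<open>1/t\<close>.\<close>
lemma inverse_1_minus_in_maximal_subring:
  fixes t :: "'a::field"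
  assumes S: "subring_of_field S" and t: "t \<in> S" "t \<noteq> 0" "inverse t \<notin> S"
    and max: "\<And>x. x \<notin> S \<Longrightarrow> inverse t \<in> adjoin S x"
    and b: "b \<in> S"
  shows "inverse (1 - t * b) \<in> S"
proof (rule ccontr)
  note ring = subring_of_fieldD[OF S]
  define c where "c = 1 - t * b"
  assume "inverse (1 - t * b) \<notin> S"
  then have "inverse c \<notin> S" by (simp add: c_def)
  then have "c \<noteq> 0" using ring(2) by auto
  obtain p where p: "poly p (inverse c) = inverse t" "\<And>i. coeff p i \<in> S"
    using max[OF \<open>inverse c \<notin> S\<close>] by (auto simp: adjoin_def)
  have "c \<in> S" unfolding c_def by (intro ring t b)
  define n where "n = degree p"
  have "c ^ n * poly p (inverse c) = (\<Sum>i\<le>n. coeff p i * c ^ (n - i))"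
    unfolding poly_altdef n_def[symmetric] sum_distrib_left
  proof (rule sum.cong)
    fix i assume "i \<in> {..n}"
    then have "c ^ n = c ^ (n - i) * c ^ i"
      by (simp flip: power_add)
    then show "c ^ n * (coeff p i * inverse c ^ i) = coeff p i * c ^ (n - i)"
      using \<open>c \<noteq> 0\<close> by (simp add: field_simps)
  qed simp
  also have "\<dots> \<in> S"
    by (intro ring p \<open>c \<in> S\<close>)
  finally have 1: "c ^ n * inverse t \<in> S" by (simp add: p)
  have 2: "(1 - c ^ n) * inverse t \<in> S"
  proof -
    have "1 - c ^ n = t * b * (\<Sum>i<n. c ^ i)"
      using one_diff_power_eq[of c n] by (simp add: c_def)
    then have "(1 - c ^ n) * inverse t = b * (\<Sum>i<n. c ^ i)"
      using t by (simp add: field_simps)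
    also have "\<dots> \<in> S" by (intro ring b \<open>c \<in> S\<close>)
    finally show ?thesis .
  qed
  from ring(5)[OF 1 2] have "inverse t \<in> S" by (simp add: algebra_simps)
  with t show False by blast
qed

lemma poly_eq_sum:
  fixes x :: "'a::comm_ring_1"
  assumes "degree p \<le> n"
  shows "poly p x = (\<Sum>i\<le>n. coeff p i * x ^ i)"
  unfolding poly_altdef
  by (rule sum.mono_neutral_left) (use assms in \<open>auto simp: coeff_eq_0\<close>)

text \<open>The descent step in the proof that a maximal subring without \<open>1/t\<close> is a valuation ring. The
  relation \<open>t q(1/x) = 1\<close> can be divided by the unit \<open>1 - t q\<^sub>0\<close>, which makes \<open>1\<close> a combination
  of \<open>x\<close> to the powers \<open>-1, \<dots>, -m\<close>. Since \<open>m \<le> n\<close>, multiplication by \<open>x\<^sup>n\<close> expresses \<open>x\<^sup>n\<close> by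
  lower powers, and substitution removes the top term of \<open>p\<close>.\<close>
lemma lower_degree:
  fixes t :: "'a::field"
  assumes S: "subring_of_field S" and t: "t \<in> S" "t \<noteq> 0" "inverse t \<notin> S"
    and unit: "\<forall>b\<in>S. inverse (1 - t * b) \<in> S"
    and "x \<noteq> 0"
    and p: "\<And>i. coeff p i \<in> S" "poly p x = inverse t" "degree p \<le> n"
    and q: "\<And>i. coeff q i \<in> S" "poly q (inverse x) = inverse t" "degree q \<le> m"
    and "0 < m" "m \<le> n"
  obtains p' where "\<And>i. coeff p' i \<in> S" "poly p' x = inverse t" "degree p' \<le> n - 1"
proof
  note ring = subring_of_fieldD[OF S]
  define c where "c = 1 - t * coeff q 0"
  have "c \<noteq> 0"
  proof
    assume "c = 0"
    then have "inverse t = coeff q 0"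
      using t by (simp add: c_def field_simps)
    with t(3) q(1)[of 0] show False by simp
  qed
  define d where "d j = coeff p n * (inverse c * (t * coeff q j))" for j
  have dS: "d j \<in> S" for j
    unfolding d_def c_def by (intro ring p q t unit[rule_format])
  have "1 = t * (\<Sum>j\<le>m. coeff q j * inverse x ^ j)"
    using q(2) t(2) by (simp add: poly_eq_sum[OF q(3), symmetric])
  also have "\<dots> = t * coeff q 0 + (\<Sum>j=1..m. t * (coeff q j * inverse x ^ j))"
    by (simp add: atMost_atLeast0 sum.atLeast_Suc_atMost distrib_left sum_distrib_left)
  finally have "c = (\<Sum>j=1..m. t * (coeff q j * inverse x ^ j))"
    by (simp add: c_def algebra_simps)
  then have "coeff p n * x ^ n = coeff p n * (inverse c * x ^ n * (\<Sum>j=1..m. t * (coeff q j * inverse x ^ j)))"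
    using \<open>c \<noteq> 0\<close> by simp
  also have "\<dots> = (\<Sum>j=1..m. d j * x ^ (n - j))"
    unfolding sum_distrib_left
  proof (rule sum.cong)
    fix j assume "j \<in> {1..m}"
    then have "x ^ n = x ^ (n - j) * x ^ j"
      using \<open>m \<le> n\<close> by (simp flip: power_add)
    then show "coeff p n * (inverse c * x ^ n * (t * (coeff q j * inverse x ^ j))) = d j * x ^ (n - j)"
      using \<open>x \<noteq> 0\<close> by (simp add: d_def field_simps)
  qed simp
  finally have top: "coeff p n * x ^ n = (\<Sum>j=1..m. d j * x ^ (n - j))" .
  define p' where "p' = (\<Sum>i<n. monom (coeff p i) i) + (\<Sum>j=1..m. monom (d j) (n - j))"
  show "coeff p' i \<in> S" for i
    unfolding p'_def coeff_add coeff_sum coeff_monom by (intro ring) (auto intro: ring p dS)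
  show "degree p' \<le> n - 1"
    unfolding p'_def using \<open>0 < m\<close> \<open>m \<le> n\<close>
    by (intro degree_add_le degree_sum_le) (auto intro: order_trans[OF degree_monom_le])
  have "poly p' x = (\<Sum>i<n. coeff p i * x ^ i) + coeff p n * x ^ n"
    by (simp add: p'_def poly_sum poly_monom top)
  also have "\<dots> = poly p x"
    by (simp add: poly_eq_sum[OF p(3)] flip: lessThan_Suc_atMost)
  finally show "poly p' x = inverse t" using p(2) by simp
qed

text \<open>A special case of Chevalley's extension theorem for places. Take a subring \<open>V\<close> that is maximal among
  those containing \<open>R\<close> but not \<open>1/t\<close>. If neither \<open>x\<close> nor \<open>1/x\<close> were in \<open>V\<close>, then \<open>1/t\<close> would be a
  polynomial over \<open>V\<close> both in \<open>x\<close> and in \<open>1/x\<close>, and of two such relations the one of larger degree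
  could always be shortened.\<close>
theorem exists_valuation_ring:
  fixes t :: "'a::field"
  assumes R: "subring_of_field R" "t \<in> R" "inverse t \<notin> R"
  obtains V where "subring_of_field V" "R \<subseteq> V" "inverse t \<notin> V"
    "\<And>x. x \<in> V \<or> inverse x \<in> V"
proof -
  have "t \<noteq> 0"
    using R subring_of_fieldD(2)[OF R(1)] by auto
  define \<A> where "\<A> = {S. subring_of_field S \<and> R \<subseteq> S \<and> inverse t \<notin> S}"
  have "\<exists>V\<in>\<A>. \<forall>S\<in>\<A>. V \<subseteq> S \<longrightarrow> S = V"
  proof (rule subset_Zorn_nonempty)
    show "\<A> \<noteq> {}" using R by (auto simp: \<A>_def)
    fix \<C> assume C: "\<C> \<noteq> {}" "subset.chain \<A> \<C>"
    have "x - y \<in> \<Union>\<C> \<and> x * y \<in> \<Union>\<C>" if xy: "x \<in> \<Union>\<C>" "y \<in> \<Union>\<C>" for x y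
    proof -
      obtain S T where "S \<in> \<C>" "x \<in> S" "T \<in> \<C>" "y \<in> T" using xy by blast
      moreover have "S \<subseteq> T \<or> T \<subseteq> S"
        using C calculation by (auto simp: subset_chain_def)
      ultimately obtain Z where "Z \<in> \<C>" "x \<in> Z" "y \<in> Z" by blast
      moreover from this have "subring_of_field Z"
        using C by (auto simp: subset_chain_def \<A>_def)
      ultimately show ?thesis
        using subring_of_fieldD(3,4) by blast
    qed
    moreover have "1 \<in> \<Union>\<C>"
      using C subring_of_fieldD(1) by (force simp: subset_chain_def \<A>_def)
    ultimately have "subring_of_field (\<Union>\<C>)"
      unfolding subring_of_field_def by blast
    moreover have "R \<subseteq> \<Union>\<C>" "inverse t \<notin> \<Union>\<C>"
      using C unfolding subset_chain_def \<A>_def by blast+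
    ultimately show "\<Union>\<C> \<in> \<A>"
      by (simp add: \<A>_def)
  qed
  then obtain V where "V \<in> \<A>" and max: "\<forall>S\<in>\<A>. V \<subseteq> S \<longrightarrow> S = V"
    by blast
  then have V: "subring_of_field V" "R \<subseteq> V" "inverse t \<notin> V"
    by (simp_all add: \<A>_def)
  have adj: "inverse t \<in> adjoin V x" if "x \<notin> V" for x
  proof (rule ccontr)
    assume "inverse t \<notin> adjoin V x"
    then have "adjoin V x \<in> \<A>"
      using adjoin[OF V(1), of x] V(2) by (auto simp: \<A>_def)
    then have "adjoin V x = V"
      using max adjoin(2)[OF V(1)] by blast
    with adjoin(3)[OF V(1)] that show False by blast
  qed
  have tV: "t \<in> V" using R V by blast
  have unit: "\<forall>b\<in>V. inverse (1 - t * b) \<in> V"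
    using inverse_1_minus_in_maximal_subring[OF V(1) tV \<open>t \<noteq> 0\<close> V(3)] adj by blast
  note ring = subring_of_fieldD[OF V(1)]
  note lower = lower_degree[OF V(1) tV \<open>t \<noteq> 0\<close> V(3) unit]
  have const: False if "\<And>i. coeff p i \<in> V" "poly p x = inverse t" "degree p \<le> 0" for p x
  proof -
    obtain a where "p = [:a:]" using \<open>degree p \<le> 0\<close> degree_eq_zeroE by blast
    with that(1)[of 0] that(2) V(3) show False by simp
  qed
  have no_relations: False
    if "x \<noteq> 0" "\<And>i. coeff p i \<in> V" "poly p x = inverse t" "degree p \<le> n"
      "\<And>i. coeff q i \<in> V" "poly q (inverse x) = inverse t" "degree q \<le> m" for x p q n m
    using that
  proof (induction "n + m" arbitrary: n m p q rule: less_induct)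
    case less
    have "0 < n" "0 < m"
      using const[OF less.prems(2,3)] const[OF less.prems(5,6)] less.prems(4,7)
      by (auto intro!: gr0I)
    show False
    proof (cases "m \<le> n")
      case True
      from lower[OF less.prems \<open>0 < m\<close> True] obtain p' where
        "\<And>i. coeff p' i \<in> V" "poly p' x = inverse t" "degree p' \<le> n - 1" by metis
      then show False
        using less.hyps[of "n - 1" m p' q] less.prems \<open>0 < n\<close> by simp
    next
      case False
      obtain q' where
        "\<And>i. coeff q' i \<in> V" "poly q' (inverse x) = inverse t" "degree q' \<le> m - 1"
        using lower[of "inverse x" q m p n] less.prems \<open>0 < n\<close> False by auto
      then show False
        using less.hyps[of n "m - 1" p q'] less.prems \<open>0 < m\<close> by simp
    qed
  qed
  have "x \<in> V \<or> inverse x \<in> V" for x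
  proof (rule ccontr)
    assume *: "\<not> ?thesis"
    then have "x \<noteq> 0" using ring(2) by auto
    obtain p where p: "inverse t = poly p x" "\<forall>i. coeff p i \<in> V"
      using adj[of x] * unfolding adjoin_def by blast
    obtain q where q: "inverse t = poly q (inverse x)" "\<forall>i. coeff q i \<in> V"
      using adj[of "inverse x"] * unfolding adjoin_def by blast
    show False
      using no_relations[OF \<open>x \<noteq> 0\<close>, of p "degree p" q "degree q"] p q by simp
  qed
  with that V show thesis by blast
qed

section \<open>Ultrapowers of fields\<close>

definition ultraeq :: "(nat \<Rightarrow> 'a) \<Rightarrow> (nat \<Rightarrow> 'a) \<Rightarrow> bool" where
  "ultraeq f g \<longleftrightarrow> (\<forall>\<^sub>F n in free_ultrafilter. f n = g n)"

lemma ultraeq_binop: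
  assumes "ultraeq f f'" "ultraeq g g'"
  shows "ultraeq (\<lambda>n. h (f n) (g n)) (\<lambda>n. h (f' n) (g' n))"
  using assms unfolding ultraeq_def by eventually_elim simp

quotient_type 'a ultrapower = "nat \<Rightarrow> 'a" / ultraeq
proof (rule equivpI)
  show "reflp ultraeq" by (simp add: reflp_def ultraeq_def)
  show "symp ultraeq" by (simp add: symp_def ultraeq_def eq_commute)
  show "transp ultraeq"
    unfolding transp_def ultraeq_def
  proof (intro allI impI)
    fix f g h
    assume "\<forall>\<^sub>F n in free_ultrafilter. f n = g n" "\<forall>\<^sub>F n in free_ultrafilter. g n = h n"
    then show "\<forall>\<^sub>F n in free_ultrafilter. f n = h n"
      by eventually_elim simp
  qed
qed

text \<open>The class of a sequence in the ultrapower.\<close>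
lift_definition up :: "(nat \<Rightarrow> 'a) \<Rightarrow> 'a ultrapower" is "\<lambda>f. f" .

lemma up_eq_iff: "up f = up g \<longleftrightarrow> (\<forall>\<^sub>F n in free_ultrafilter. f n = g n)"
  by transfer (simp add: ultraeq_def)

instantiation ultrapower :: (field) field
begin

lift_definition zero_ultrapower :: "'a ultrapower" is "\<lambda>_. 0" .
lift_definition one_ultrapower :: "'a ultrapower" is "\<lambda>_. 1" .
lift_definition plus_ultrapower :: "'a ultrapower \<Rightarrow> 'a ultrapower \<Rightarrow> 'a ultrapower"
  is "\<lambda>f g n. f n + g n" by (rule ultraeq_binop[where h = "(+)"])
lift_definition minus_ultrapower :: "'a ultrapower \<Rightarrow> 'a ultrapower \<Rightarrow> 'a ultrapower"
  is "\<lambda>f g n. f n - g n" by (rule ultraeq_binop[where h = "(-)"])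
lift_definition times_ultrapower :: "'a ultrapower \<Rightarrow> 'a ultrapower \<Rightarrow> 'a ultrapower"
  is "\<lambda>f g n. f n * g n" by (rule ultraeq_binop[where h = "(*)"])
lift_definition divide_ultrapower :: "'a ultrapower \<Rightarrow> 'a ultrapower \<Rightarrow> 'a ultrapower"
  is "\<lambda>f g n. f n / g n" by (rule ultraeq_binop[where h = "(/)"])
lift_definition uminus_ultrapower :: "'a ultrapower \<Rightarrow> 'a ultrapower"
  is "\<lambda>f n. - f n" unfolding ultraeq_def by (auto elim: eventually_mono)
lift_definition inverse_ultrapower :: "'a ultrapower \<Rightarrow> 'a ultrapower"
  is "\<lambda>f n. inverse (f n)" unfolding ultraeq_def by (auto elim: eventually_mono)

instance
proof
  fix x :: "'a ultrapower"
  show "x \<noteq> 0 \<Longrightarrow> inverse x * x = 1"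
    by transfer (auto simp: ultraeq_def simp flip: eventually_not_free_ultrafilter elim!: eventually_mono)
qed (transfer; simp add: ultraeq_def algebra_simps divide_inverse)+

end

lemma up_simps:
  shows up_0: "up (\<lambda>_. 0) = 0" and up_1: "up (\<lambda>_. 1) = 1"
    and up_add: "up (\<lambda>n. f n + g n) = up f + up g"
    and up_diff: "up (\<lambda>n. f n - g n) = up f - up g"
    and up_mult: "up (\<lambda>n. f n * g n) = up f * up g"
    and up_inverse: "up (\<lambda>n. inverse (f n)) = inverse (up f)"
    and up_divide: "up (\<lambda>n. f n / g n) = up f / up g"
  by (transfer; simp add: ultraeq_def)+

lemma two_eq_0_ultrapower:
  assumes "(2::'a::field) = 0"
  shows "(2::'a ultrapower) = 0"
proof -
  have "(2::'a ultrapower) = up (\<lambda>_. 1 + 1)"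
    unfolding up_add up_1 by (rule one_add_one[symmetric])
  also have "\<dots> = 0"
    by (simp only: one_add_one assms up_0)
  finally show ?thesis .
qed

text \<open>The range in question is the ring \<open>k[t]\<close> of the polynomials with constant coefficients in the class
  \<open>t\<close> of \<open>\<tau>\<close>. A nonzero polynomial has finitely many roots, and \<open>\<tau>\<close> takes each of them only
  once, so \<open>t\<close> is not a root; applied to \<open>X f - 1\<close>, this shows that \<open>f(t)\<close> is not the inverse of \<open>t\<close>.\<close>
lemma transcendental_up:
  fixes \<tau> :: "nat \<Rightarrow> 'a::field"
  assumes "inj \<tau>"
  defines "R \<equiv> range (\<lambda>f. up (\<lambda>n. poly f (\<tau> n)))"
  shows "subring_of_field R" "up \<tau> \<in> R" "up (\<lambda>_. a) \<in> R" "inverse (up \<tau>) \<notin> R"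
proof -
  have R: "up (\<lambda>n. poly f (\<tau> n)) \<in> R" for f by (auto simp: R_def)
  show "subring_of_field R"
    unfolding subring_of_field_def
  proof (intro conjI ballI)
    show "1 \<in> R" using R[of 1] by (simp add: up_1)
    fix x y assume "x \<in> R" "y \<in> R"
    then obtain f g where "x = up (\<lambda>n. poly f (\<tau> n))" "y = up (\<lambda>n. poly g (\<tau> n))"
      by (auto simp: R_def)
    then show "x - y \<in> R" "x * y \<in> R"
      using R[of "f - g"] R[of "f * g"] by (simp_all add: up_simps)
  qed
  show "up \<tau> \<in> R" using R[of "[:0, 1:]"] by simp
  show "up (\<lambda>_. a) \<in> R" using R[of "[:a:]"] by simp
  have no_root: "\<not> (\<forall>\<^sub>F n in free_ultrafilter. poly p (\<tau> n) = 0)" if "p \<noteq> 0" for p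
  proof -
    have "finite {n. poly p (\<tau> n) = 0}"
      using finite_vimageI[OF poly_roots_finite[OF that] assms(1)] by (simp add: vimage_def)
    then have "\<forall>\<^sub>F n in sequentially. poly p (\<tau> n) \<noteq> 0"
      by (simp add: eventually_cofinite flip: cofinite_eq_sequentially)
    then show ?thesis
      using eventually_free_ultrafilterI by force
  qed
  show "inverse (up \<tau>) \<notin> R"
  proof
    assume "inverse (up \<tau>) \<in> R"
    then obtain f where f: "inverse (up \<tau>) = up (\<lambda>n. poly f (\<tau> n))"
      by (auto simp: R_def)
    have "up \<tau> \<noteq> 0"
      using no_root[of "[:0, 1:]"] by (simp add: up_eq_iff flip: up_0)
    then have "up \<tau> * up (\<lambda>n. poly f (\<tau> n)) = 1"
      by (simp flip: f)
    then have "\<forall>\<^sub>F n in free_ultrafilter. poly ([:0, 1:] * f - 1) (\<tau> n) = 0"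
      by (simp add: up_eq_iff flip: up_mult up_1)
    moreover have "[:0, 1:] * f - 1 \<noteq> 0"
    proof
      assume "[:0, 1:] * f - 1 = 0"
      then have "poly ([:0, 1:] * f - 1) 0 = 0" by (simp only: poly_0)
      then show False by simp
    qed
    ultimately show False using no_root by blast
  qed
qed

section \<open>The algebraic closure of the field with two elements\<close>

text \<open>Otherwise the polynomial that is \<open>1\<close> more than the product of all \<open>X - a\<close> would have no root.\<close>
lemma infinite_alg_closed_field: "infinite (UNIV :: 'a::alg_closed_field set)"
proof
  assume fin: "finite (UNIV :: 'a set)"
  define p :: "'a poly" where "p = (\<Prod>a\<in>UNIV. [:-a, 1:])"
  have "degree p = card (UNIV :: 'a set)"
    unfolding p_def by (subst degree_prod_eq_sum_degree) auto
  then have "degree (p + 1) > 0"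
    using fin by (subst degree_add_eq_left) (auto simp: card_gt_0_iff)
  then obtain a where "poly (p + 1) a = 0"
    using alg_closed_imp_poly_has_root by blast
  moreover have "poly p a = 0"
    using fin by (simp add: p_def poly_prod prod_zero_iff)
  ultimately show False by simp
qed

lemma two_eq_0_alg_closure_bit: "(2 :: bit alg_closure) = 0"
  using to_ac_numeral[where 'a = bit, of "num.Bit0 num.One"] by simp

lemma power_two_power_add:
  fixes x y :: "'a::comm_ring_1"
  assumes "(2::'a) = 0"
  shows "(x + y) ^ (2 ^ n) = x ^ (2 ^ n) + y ^ (2 ^ n)"
proof (induction n)
  case (Suc n)
  have "(x + y) ^ (2 ^ Suc n) = ((x + y) ^ (2 ^ n)) ^ 2"
    by (simp add: power_mult[symmetric] mult.commute)
  also have "\<dots> = (x ^ (2 ^ n)) ^ 2 + (y ^ (2 ^ n)) ^ 2"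
    by (simp add: Suc power2_sum assms)
  also have "\<dots> = x ^ (2 ^ Suc n) + y ^ (2 ^ Suc n)"
    by (simp add: power_mult[symmetric] mult.commute)
  finally show ?case .
qed simp

lemma power_two_power_fixed_dvd:
  fixes x :: "'a::monoid_mult"
  assumes "x ^ (2 ^ m) = x" "m dvd n"
  shows "x ^ (2 ^ n) = x"
proof -
  obtain l where n: "n = m * l" using assms(2) by auto
  show ?thesis unfolding n
  proof (induction l)
    case (Suc l)
    have "x ^ (2 ^ (m * Suc l)) = (x ^ (2 ^ (m * l))) ^ (2 ^ m)"
      by (simp add: power_mult[symmetric] power_add[symmetric] add.commute)
    then show ?case by (simp add: Suc assms(1))
  qed simp
qed

lemma finite_poly_degree_less: "finite {p :: 'a::{finite, zero} poly. degree p < d}"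
proof (rule finite_subset)
  show "{p :: 'a poly. degree p < d} \<subseteq> Poly ` {xs. set xs \<subseteq> UNIV \<and> length xs \<le> d}"
  proof
    fix p :: "'a poly" assume "p \<in> {p. degree p < d}"
    then have "length (coeffs p) \<le> d"
      by (cases "p = 0") (auto simp: length_coeffs_degree)
    then show "p \<in> Poly ` {xs. set xs \<subseteq> UNIV \<and> length xs \<le> d}"
      by (intro image_eqI[of _ _ "coeffs p"]) auto
  qed
  show "finite (Poly ` {xs :: 'a list. set xs \<subseteq> UNIV \<and> length xs \<le> d})"
    by (intro finite_imageI finite_lists_length_le finite)
qed

instance bit :: finite
proof
  have "(UNIV :: bit set) \<subseteq> {0, 1}" by (auto intro: bit.exhaust)
  then show "finite (UNIV :: bit set)" by (rule finite_subset) simp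
qed

lemma map_poly_to_ac_hom:
  "map_poly to_ac (p + q) = map_poly to_ac p + map_poly to_ac q"
  "map_poly to_ac (p * q) = map_poly to_ac p * map_poly to_ac q"
  by (auto intro!: poly_eqI simp: coeff_map_poly coeff_mult to_ac_sum)

text \<open>If \<open>f\<close> is a nonzero polynomial over the two-element field with root \<open>x\<close>, then reduction modulo \<open>f\<close>
  writes each power of \<open>x\<close> as the value of one of finitely many polynomials. So two iterates of the
  Frobenius map agree on \<open>x\<close>, and since that map is injective its iterates return to \<open>x\<close>.\<close>
lemma alg_closure_bit_frobenius_periodic:
  fixes x :: "bit alg_closure"
  obtains m where "m > 0" "x ^ (2 ^ m) = x"
proof -
  obtain f :: "bit poly" where f: "f \<noteq> 0" "poly (map_poly to_ac f) x = 0"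
    by (rule alg_closure_algebraic)
  define ev where "ev p = poly (map_poly to_ac p) x" for p :: "bit poly"
  have "x ^ i \<in> ev ` {p. degree p < Suc (degree f)}" for i
  proof -
    have "x ^ i = ev (monom 1 i)"
      by (simp add: ev_def map_poly_monom poly_monom)
    also have "monom 1 i = f * (monom 1 i div f) + monom 1 i mod f" by simp
    also have "ev \<dots> = ev (monom 1 i mod f)"
      using f(2) by (simp only: ev_def map_poly_to_ac_hom poly_add poly_mult) simp
    finally have "x ^ i = ev (monom 1 i mod f)" .
    moreover have "degree (monom 1 i mod f) < Suc (degree f)"
      using degree_mod_less[OF f(1), of "monom 1 i"] by auto
    ultimately show ?thesis by blast
  qed
  then have "range (\<lambda>i. x ^ (2 ^ i)) \<subseteq> ev ` {p. degree p < Suc (degree f)}" by blast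
  then have "finite (range (\<lambda>i. x ^ (2 ^ i :: nat)))"
    using finite_poly_degree_less finite_subset by blast
  then have "\<not> inj (\<lambda>i. x ^ (2 ^ i :: nat))"
    using finite_imageD infinite_UNIV_nat by blast
  then obtain i j :: nat where "i \<noteq> j" "x ^ (2 ^ i) = x ^ (2 ^ j)"
    by (auto simp: inj_def)
  then obtain i j :: nat where ij: "i < j" "x ^ (2 ^ i) = x ^ (2 ^ j)"
    by (metis nat_neq_iff)
  have "(x ^ (2 ^ (j - i)) + x) ^ (2 ^ i) = x ^ (2 ^ (j - i) * 2 ^ i) + x ^ (2 ^ i)"
    by (simp add: power_two_power_add two_eq_0_alg_closure_bit power_mult)
  also have "2 ^ (j - i) * 2 ^ i = (2 ^ j :: nat)"
    using ij(1) by (simp flip: power_add)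
  also have "x ^ (2 ^ j) + x ^ (2 ^ i) = 2 * x ^ (2 ^ i)"
    using ij(2) by simp
  also have "\<dots> = 0"
    by (simp add: two_eq_0_alg_closure_bit)
  finally have "x ^ (2 ^ (j - i)) + x = 0" by simp
  then have "x ^ (2 ^ (j - i)) + 2 * x = x"
    by (simp only: mult_2 add.assoc[symmetric]) simp
  then have "x ^ (2 ^ (j - i)) = x"
    by (simp add: two_eq_0_alg_closure_bit)
  with ij(1) show thesis by (intro that[of "j - i"]) auto
qed

text \<open>The field with \<open>2\<close> to the power \<open>n!\<close> elements. The factorials make these fields increase to the
  whole algebraic closure.\<close>
definition finite_subfield :: "nat \<Rightarrow> bit alg_closure set" where
  "finite_subfield n = {x. x ^ (2 ^ fact n) = x}"

lemma finite_finite_subfield: "finite (finite_subfield n)"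
proof -
  define p :: "bit alg_closure poly" where "p = monom 1 (2 ^ fact n) - monom 1 1"
  have "(2::nat) ^ fact n > 1" by (rule one_less_power) (auto simp: fact_gt_zero)
  then have "coeff p 1 = - 1" by (simp add: p_def)
  then have "p \<noteq> 0" by auto
  then have "finite {x. poly p x = 0}" by (rule poly_roots_finite)
  then show ?thesis
    by (rule finite_subset[rotated]) (auto simp: finite_subfield_def p_def poly_monom)
qed

lemma finite_subfield_closed:
  shows "0 \<in> finite_subfield n" "1 \<in> finite_subfield n"
    and "x \<in> finite_subfield n \<Longrightarrow> y \<in> finite_subfield n \<Longrightarrow> x + y \<in> finite_subfield n"
    and "x \<in> finite_subfield n \<Longrightarrow> y \<in> finite_subfield n \<Longrightarrow> x * y \<in> finite_subfield n"
  by (simp_all add: finite_subfield_def power_mult_distrib power_two_power_add two_eq_0_alg_closure_bit)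

lemma eventually_in_finite_subfield: "\<forall>\<^sub>F n in sequentially. x \<in> finite_subfield n"
proof -
  obtain m where m: "m > 0" "x ^ (2 ^ m) = x"
    by (rule alg_closure_bit_frobenius_periodic)
  have "x \<in> finite_subfield n" if "n \<ge> m" for n
    using power_two_power_fixed_dvd[OF m(2) dvd_fact[of m n]] m(1) that
    by (simp add: finite_subfield_def)
  then show ?thesis
    by (auto simp: eventually_sequentially)
qed

lemma countable_alg_closure_bit: "countable (UNIV :: bit alg_closure set)"
proof -
  have "x \<in> (\<Union>n. finite_subfield n)" for x
    using eventually_happens'[OF sequentially_bot eventually_in_finite_subfield[of x]] by blast
  then have "UNIV = (\<Union>n. finite_subfield n)" by blast
  moreover have "countable (\<Union>n. finite_subfield n)"
    by (simp add: countable_finite finite_finite_subfield)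
  ultimately show ?thesis by simp
qed

section \<open>Two-by-two matrices and their eigenvectors\<close>

definition mat2 :: "'a::zero \<Rightarrow> 'a \<Rightarrow> 'a \<Rightarrow> 'a \<Rightarrow> 'a^2^2" where
  "mat2 a b c d = vector [vector [a, b], vector [c, d]]"

lemma mat2_nth [simp]:
  "mat2 a b c d $ 1 $ 1 = a" "mat2 a b c d $ 1 $ 2 = b"
  "mat2 a b c d $ 2 $ 1 = c" "mat2 a b c d $ 2 $ 2 = d"
  by (simp_all add: mat2_def)

lemma mat_eq_iff_2:
  "A = B \<longleftrightarrow> A$1$1 = B$1$1 \<and> A$1$2 = B$1$2 \<and> A$2$1 = B$2$1 \<and> A$2$2 = (B :: 'a^2^2)$2$2"
  by (auto simp: vec_eq_iff forall_2)

lemma vec_eq_iff_2: "v = w \<longleftrightarrow> v$1 = w$1 \<and> v$2 = (w :: 'a^2)$2"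
  by (auto simp: vec_eq_iff forall_2)

lemma matrix_mult_2_nth:
  "(A ** B) $ i $ j = A$i$1 * B$1$j + A$i$2 * (B :: 'a::semiring_1^2^2)$2$j"
  by (simp add: matrix_matrix_mult_def sum_2)

lemma matrix_vector_mult_2_nth:
  "(A *v v) $ i = A$i$1 * v$1 + A$i$2 * (v :: 'a::semiring_1^2)$2"
  by (simp add: matrix_vector_mult_def sum_2)

lemma mat_1_2_nth [simp]:
  "(mat 1 :: 'a::zero_neq_one^2^2) $ 1 $ 1 = 1" "(mat 1 :: 'a^2^2) $ 1 $ 2 = 0"
  "(mat 1 :: 'a^2^2) $ 2 $ 1 = 0" "(mat 1 :: 'a^2^2) $ 2 $ 2 = 1"
  by (simp_all add: mat_def)

text \<open>If \<open>c\<close> is an eigenvalue and the lower left entry is not zero, then the second row of \<open>A\<close> determines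
  an eigenvector.\<close>
lemma ex_eigenvector_2:
  fixes A :: "'a::alg_closed_field^2^2"
  obtains w c where "w \<noteq> 0" "A *v w = c *s w"
proof (cases "A$2$1 = 0")
  case True
  show thesis
    by (rule that[of "vector [1, 0]" "A$1$1"])
      (simp_all add: vec_eq_iff_2 matrix_vector_mult_2_nth True)
next
  case False
  obtain c where "poly [:det A, - (A$1$1 + A$2$2), 1:] c = 0"
    using alg_closed_imp_poly_has_root[of "[:det A, - (A$1$1 + A$2$2), 1:]"] by auto
  then have "A$1$1 * (c - A$2$2) + A$1$2 * A$2$1 = c * (c - A$2$2)"
    by (simp add: det_2 algebra_simps)
  then show thesis
    by (intro that[of "vector [c - A$2$2, A$2$1]" c])
      (simp_all add: vec_eq_iff_2 matrix_vector_mult_2_nth False algebra_simps)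
qed

text \<open>The slopes of the eigenvectors are the fixed points of the Moebius transformation given by \<open>A\<close>,
  that is, the roots of a quadratic equation.\<close>
lemma eigenvector_slope:
  fixes A :: "'a::field^2^2"
  assumes eigen: "A *v w = c *s w" and "w $ 2 \<noteq> 0"
  defines "r \<equiv> w $ 1 / w $ 2"
  shows "A$2$1 * r * r + (A$2$2 - A$1$1) * r = A$1$2"
proof -
  have "w $ 1 = r * w $ 2"
    using \<open>w $ 2 \<noteq> 0\<close> by (simp add: r_def)
  moreover have "A$1$1 * w $ 1 + A$1$2 * w $ 2 = c * w $ 1"
    "A$2$1 * w $ 1 + A$2$2 * w $ 2 = c * w $ 2"
    using eigen by (simp_all add: vec_eq_iff_2 matrix_vector_mult_2_nth)
  ultimately have "(A$1$1 * r + A$1$2) * w $ 2 = (c * r) * w $ 2"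
    "(A$2$1 * r + A$2$2) * w $ 2 = c * w $ 2"
    by (simp_all add: algebra_simps)
  then have "A$1$1 * r + A$1$2 = c * r" and c: "A$2$1 * r + A$2$2 = c"
    using \<open>w $ 2 \<noteq> 0\<close> by simp_all
  then have "A$1$2 = (A$2$1 * r + A$2$2) * r - A$1$1 * r"
    unfolding c by (simp add: eq_diff_eq add.commute)
  then show ?thesis by (simp add: algebra_simps)
qed

text \<open>A quadratic equation with three roots is trivial, so \<open>A\<close> is a scalar matrix. Its determinant being
  \<open>1\<close>, the scalar has square \<open>1\<close> and so equals \<open>1\<close> in characteristic two.\<close>
lemma mat_1_if_three_slopes:
  fixes A :: "'a::field^2^2"
  assumes "det A = 1" "(2::'a) = 0"
    and quad: "\<And>x. x \<in> {r, s, u} \<Longrightarrow> A$2$1 * x * x + (A$2$2 - A$1$1) * x = A$1$2"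
    and distinct: "r \<noteq> s" "r \<noteq> u" "s \<noteq> u"
  shows "A = mat 1"
proof -
  have slope: "A$2$1 * (x + y) + (A$2$2 - A$1$1) = 0" if "x \<in> {r, s, u}" "y \<in> {r, s, u}" "x \<noteq> y" for x y
  proof -
    have "(A$2$1 * (x + y) + (A$2$2 - A$1$1)) * (x - y) = 0"
      using quad[OF that(1)] quad[OF that(2)] by (simp add: algebra_simps)
    then show ?thesis using that(3) by simp
  qed
  have slope1: "A$2$1 * (r + s) + (A$2$2 - A$1$1) = 0"
    and slope2: "A$2$1 * (r + u) + (A$2$2 - A$1$1) = 0"
    using distinct by (intro slope; simp)+
  have "A$2$1 * (s - u) = (A$2$1 * (r + s) + (A$2$2 - A$1$1)) - (A$2$1 * (r + u) + (A$2$2 - A$1$1))"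
    by (simp add: algebra_simps)
  also have "\<dots> = 0" unfolding slope1 slope2 by simp
  finally have A21: "A$2$1 = 0" using distinct(3) by simp
  then have A22: "A$2$2 = A$1$1" using slope1 by simp
  have A12: "A$1$2 = 0" using quad[of r] A21 A22 by simp
  have "(A$1$1 - 1) ^ 2 = 0"
    using assms(1,2) A12 A21 A22 by (simp add: det_2 power2_eq_square algebra_simps)
  then show ?thesis using A12 A21 A22 by (simp add: mat_eq_iff_2)
qed

section \<open>The special linear group of degree two\<close>

definition SL2 :: "('a::field^2^2) monoid" where
  "SL2 = \<lparr>carrier = {A. det A = 1}, monoid.mult = (**), monoid.one = mat 1\<rparr>"

lemma SL2_simps [simp]:
  "A \<in> carrier SL2 \<longleftrightarrow> det A = 1" "A \<otimes>\<^bsub>SL2\<^esub> B = A ** B" "\<one>\<^bsub>SL2\<^esub> = mat 1"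
  by (simp_all add: SL2_def)

lemma adjugate_2:
  fixes A :: "'a::field^2^2"
  assumes "det A = 1"
  shows "det (mat2 (A$2$2) (- A$1$2) (- A$2$1) (A$1$1)) = 1"
    and "mat2 (A$2$2) (- A$1$2) (- A$2$1) (A$1$1) ** A = mat 1"
  using assms by (simp_all add: det_2 mat_eq_iff_2 matrix_mult_2_nth algebra_simps)

lemma group_SL2: "group (SL2 :: ('a::field^2^2) monoid)"
proof (rule groupI)
  fix A :: "'a^2^2" assume "A \<in> carrier SL2"
  then show "\<exists>B\<in>carrier SL2. B \<otimes>\<^bsub>SL2\<^esub> A = \<one>\<^bsub>SL2\<^esub>"
    using adjugate_2[of A] by (auto simp del: mat2_nth)
qed (auto simp: det_mul matrix_mul_assoc)

text \<open>Conjugation by upper or lower unipotent matrices with parameter \<open>s\<close> changes some entry of \<open>A\<close> by a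
  nonzero multiple of \<open>s\<close>, unless \<open>A\<close> is a scalar matrix. In characteristic two the only scalar matrix
  of determinant \<open>1\<close> is the identity.\<close>
lemma infinite_conjugates_SL2:
  fixes A :: "'a::field^2^2"
  assumes inf: "infinite (UNIV :: 'a set)" and char: "(2::'a) = 0"
    and A: "det A = 1" "A \<noteq> mat 1"
  shows "infinite {B \<otimes>\<^bsub>SL2\<^esub> A \<otimes>\<^bsub>SL2\<^esub> inv\<^bsub>SL2\<^esub> B | B. B \<in> carrier SL2}" (is "infinite ?C")
proof -
  interpret group "SL2 :: ('a^2^2) monoid" by (rule group_SL2)
  have inv_unipotent: "inv\<^bsub>SL2\<^esub> (mat2 1 s 0 1) = mat2 1 (- s) 0 1" "inv\<^bsub>SL2\<^esub> (mat2 1 0 s 1) = mat2 1 0 (- s) 1" for s :: 'a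
    by (rule inv_equality; simp add: det_2 mat_eq_iff_2 matrix_mult_2_nth)+
  define C where "C s = mat2 1 s 0 1 ** A ** mat2 1 (- s) 0 1" for s
  define D where "D s = mat2 1 0 s 1 ** A ** mat2 1 0 (- s) 1" for s
  have CD: "range C \<subseteq> ?C" "range D \<subseteq> ?C"
  proof -
    have "C s = mat2 1 s 0 1 \<otimes>\<^bsub>SL2\<^esub> A \<otimes>\<^bsub>SL2\<^esub> inv\<^bsub>SL2\<^esub> (mat2 1 s 0 1)"
      "D s = mat2 1 0 s 1 \<otimes>\<^bsub>SL2\<^esub> A \<otimes>\<^bsub>SL2\<^esub> inv\<^bsub>SL2\<^esub> (mat2 1 0 s 1)" for s
      by (simp_all add: C_def D_def inv_unipotent)
    moreover have "mat2 1 s 0 1 \<in> carrier SL2" "mat2 1 0 s 1 \<in> carrier SL2" for s :: 'a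
      by (simp_all add: det_2)
    ultimately show "range C \<subseteq> ?C" "range D \<subseteq> ?C" by blast+
  qed
  have infinite_range: "infinite (range f)" if "inj f" for f :: "'a \<Rightarrow> 'a^2^2"
    using inf finite_imageD[OF _ that] by blast
  consider "A$2$1 \<noteq> 0" | "A$1$2 \<noteq> 0" | "A$2$1 = 0" "A$1$2 = 0" by blast
  then show ?thesis
  proof cases
    case 1
    have "(C s)$1$1 = A$1$1 + s * A$2$1" for s
      by (simp add: C_def matrix_mult_2_nth)
    then have "inj C" using 1 by (intro injI) (metis add_left_cancel mult_right_cancel)
    then show ?thesis using infinite_range CD finite_subset by blast
  next
    case 2
    have "(D s)$2$2 = A$2$2 + s * A$1$2" for s
      by (simp add: D_def matrix_mult_2_nth)
    then have "inj D" using 2 by (intro injI) (metis add_left_cancel mult_right_cancel)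
    then show ?thesis using infinite_range CD finite_subset by blast
  next
    case 3
    have "A$2$2 \<noteq> A$1$1"
    proof
      assume eq: "A$2$2 = A$1$1"
      have "(A$1$1 - 1) ^ 2 = 0"
        using A(1) 3 eq char by (simp add: det_2 power2_eq_square algebra_simps)
      then show False
        using A(2) 3 eq by (simp add: mat_eq_iff_2)
    qed
    moreover have "(C s)$1$2 = s * (A$2$2 - A$1$1)" for s
      using 3 by (simp add: C_def matrix_mult_2_nth algebra_simps)
    ultimately have "inj C"
      by (intro injI) (metis eq_iff_diff_eq_0 mult_right_cancel)
    then show ?thesis using infinite_range CD finite_subset by blast
  qed
qed

section \<open>Ping-pong on the projective line over a valued field\<close>

text \<open>The matrix with eigenvalue \<open>t\<close> on the vector \<open>(a + 1, 1)\<close> and eigenvalue \<open>1/t\<close> on \<open>(a, 1)\<close>. These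
  two vectors form a basis of determinant \<open>1\<close> for every \<open>a\<close>.\<close>
definition hyperbolic :: "'a::field \<Rightarrow> 'a \<Rightarrow> 'a^2^2" where
  "hyperbolic a t = mat2 ((a + 1) * t - a / t) (a * (a + 1) * (1 / t - t))
     (t - 1 / t) ((a + 1) / t - a * t)"

lemma det_hyperbolic: "t \<noteq> 0 \<Longrightarrow> det (hyperbolic a t) = 1"
  by (simp add: hyperbolic_def det_2 field_simps)

text \<open>For \<open>t \<noteq> 0\<close>, the nonzero multiples of the vectors \<open>(x, 1)\<close> with \<open>x\<close> congruent to \<open>z\<close> modulo \<open>t V\<close>: a small
  neighbourhood of the point \<open>z\<close> of the projective line when \<open>V\<close> is a valuation ring and \<open>t\<close> lies in
  its maximal ideal.\<close>
definition near :: "'a::field set \<Rightarrow> 'a \<Rightarrow> 'a \<Rightarrow> ('a^2) set" where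
  "near V t z = {w. w$2 \<noteq> 0 \<and> (w$1 / w$2 - z) / t \<in> V}"

text \<open>Let \<open>p\<close> and \<open>q\<close> be the coordinates of \<open>w\<close> in the basis \<open>(a + 1, 1), (a, 1)\<close>. Being far from \<open>a + 1\<close>
  means that \<open>q/p\<close> is not in \<open>t V\<close>, so that \<open>t p\<close> is in \<open>q V\<close> as \<open>V\<close> is a valuation ring. The new
  coordinates are \<open>t p\<close> and \<open>q/t\<close>, with quotient in \<open>t V\<close>, which means being close to \<open>a\<close>.\<close>
lemma hyperbolic_ping_pong:
  fixes t :: "'a::field"
  assumes V: "subring_of_field V" "\<And>x. x \<in> V \<or> inverse x \<in> V" and t: "t \<in> V" "inverse t \<notin> V"
    and w: "w \<noteq> 0" "w \<notin> near V t (a + 1)"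
  shows "hyperbolic a t *v w \<in> near V t a"
proof -
  note ring = subring_of_fieldD[OF V(1)]
  have "t \<noteq> 0" using t ring(2) by auto
  \<comment> \<open>The element \<open>t\<close> lies in the maximal ideal of the valuation ring, so \<open>1 + t y\<close> is a unit.\<close>
  have unit: "1 + t * y \<noteq> 0 \<and> inverse (1 + t * y) \<in> V" if y: "y \<in> V" for y
  proof
    show nz: "1 + t * y \<noteq> 0"
    proof
      assume "1 + t * y = 0"
      then have "inverse t = 0 - y"
        using \<open>t \<noteq> 0\<close> by (simp add: field_simps add_eq_0_iff)
      with t(2) ring(3)[OF ring(2) y] show False by simp
    qed
    have "t / (1 + t * y) \<in> V"
    proof (rule ccontr)
      assume "t / (1 + t * y) \<notin> V"
      then have "inverse (t / (1 + t * y)) \<in> V" using V(2) by blast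
      then have "(1 + t * y) / t - y \<in> V" using ring(3) y by simp
      also have "(1 + t * y) / t - y = inverse t"
        using \<open>t \<noteq> 0\<close> by (simp add: field_simps)
      finally show False using t by simp
    qed
    then have "1 - y * (t / (1 + t * y)) \<in> V"
      by (intro ring y)
    also have "1 - y * (t / (1 + t * y)) = inverse (1 + t * y)"
      using nz by (simp add: field_simps)
    finally show "inverse (1 + t * y) \<in> V" .
  qed
  \<comment> \<open>the coordinates of \<open>w\<close> in the eigenbasis\<close>
  define p q where "p = w$1 - a * w$2" and "q = (a + 1) * w$2 - w$1"
  have w_pq: "w$1 = (a + 1) * p + a * q" "w$2 = p + q"
    by (simp_all add: p_def q_def algebra_simps)
  have "p \<noteq> 0 \<or> q \<noteq> 0"
    using w(1) by (auto simp: vec_eq_iff_2 w_pq)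
  have not_repelled: "q \<noteq> t * p * y" if "y \<in> V" for y
  proof
    assume q: "q = t * p * y"
    with \<open>p \<noteq> 0 \<or> q \<noteq> 0\<close> have "p \<noteq> 0" by auto
    define d where "d = 1 + t * y"
    have w2: "w$2 = p * d"
      by (simp add: w_pq q d_def algebra_simps)
    have "d \<noteq> 0" using unit[OF that] by (simp add: d_def)
    have "w$1 / w$2 - (a + 1) = (w$1 - (a + 1) * w$2) / w$2"
      using \<open>p \<noteq> 0\<close> \<open>d \<noteq> 0\<close> by (simp add: w2 diff_divide_distrib)
    also have "w$1 - (a + 1) * w$2 = - (t * p * y)"
      using q minus_diff_eq[of "(a + 1) * w$2" "w$1"] by (simp only: q_def)
    finally have "(w$1 / w$2 - (a + 1)) / t = (0 - y) * inverse d"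
      using \<open>p \<noteq> 0\<close> \<open>t \<noteq> 0\<close> \<open>d \<noteq> 0\<close> by (simp add: w2 field_simps)
    also have "\<dots> \<in> V"
      unfolding d_def using unit[OF that] by (intro ring that) auto
    finally have "w \<in> near V t (a + 1)"
      using \<open>p \<noteq> 0\<close> \<open>d \<noteq> 0\<close> by (simp add: near_def w2)
    with w(2) show False by contradiction
  qed
  then have "q \<noteq> 0" using ring(2) by fastforce
  obtain y where y: "y \<in> V" "t * p = q * y"
  proof (cases "t * p / q \<in> V")
    case True
    then show thesis using that \<open>q \<noteq> 0\<close> by simp
  next
    case False
    then have "q / (t * p) \<in> V" "p \<noteq> 0"
      using V(2)[of "t * p / q"] ring(2) by auto
    then show thesis
      using not_repelled[of "q / (t * p)"] \<open>t \<noteq> 0\<close> by simp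
  qed
  define w' where "w' = hyperbolic a t *v w"
  have w': "w'$1 = (a + 1) * (t * p) + a * (q / t)" "w'$2 = t * p + q / t"
    unfolding w'_def p_def q_def
    by (simp_all add: hyperbolic_def matrix_vector_mult_2_nth diff_divide_distrib add_divide_distrib algebra_simps)
  define d where "d = 1 + t * y"
  have d: "d \<noteq> 0" "inverse d \<in> V" using unit[OF y(1)] by (simp_all add: d_def)
  have w2: "w'$2 = q / t * d"
    using y(2) \<open>t \<noteq> 0\<close> by (simp add: w' d_def field_simps)
  then have "w'$2 \<noteq> 0" using \<open>q \<noteq> 0\<close> \<open>t \<noteq> 0\<close> d by simp
  then have "w'$1 / w'$2 - a = (w'$1 - a * w'$2) / w'$2"
    by (simp add: diff_divide_distrib)
  also have "w'$1 - a * w'$2 = q * y"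
    using y(2) by (simp add: w' algebra_simps)
  finally have "(w'$1 / w'$2 - a) / t = y * inverse d"
    using \<open>q \<noteq> 0\<close> \<open>t \<noteq> 0\<close> d(1) by (simp add: w2 field_simps)
  moreover have "y * inverse d \<in> V"
    by (intro ring y d)
  ultimately show ?thesis
    using \<open>w'$2 \<noteq> 0\<close> by (simp add: near_def w'_def)
qed

text \<open>If two vectors of equal slope were near \<open>z\<close> and near \<open>z'\<close>, then \<open>(z - z')/t\<close> would be
  in \<open>V\<close>, and so would \<open>1/t\<close> after multiplication by \<open>1/(z - z')\<close>.\<close>
lemma near_disjoint:
  assumes V: "subring_of_field V" "inverse t \<notin> V" and z: "z \<noteq> z'" "inverse (z - z') \<in> V"
    and near: "v \<in> near V t z" "w \<in> near V t z'"
  shows "v$1 / v$2 \<noteq> w$1 / w$2"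
proof
  note ring = subring_of_fieldD[OF V(1)]
  assume eq: "v$1 / v$2 = w$1 / w$2"
  have "(w$1 / w$2 - z') / t - (v$1 / v$2 - z) / t \<in> V"
    using near by (intro ring) (auto simp: near_def)
  also have "(w$1 / w$2 - z') / t - (v$1 / v$2 - z) / t = (z - z') / t"
    unfolding eq diff_divide_distrib[symmetric] by simp
  finally have "inverse (z - z') * ((z - z') / t) \<in> V"
    by (rule ring(4)[OF z(2)])
  then show False
    using z(1) V(2) by (simp add: inverse_eq_divide)
qed

section \<open>Matrices over an ultrapower\<close>

definition umat :: "(nat \<Rightarrow> 'a::field^2^2) \<Rightarrow> 'a ultrapower^2^2" where
  "umat A = (\<chi> i j. up (\<lambda>n. A n $ i $ j))"

definition uvec :: "(nat \<Rightarrow> 'a::field^2) \<Rightarrow> 'a ultrapower^2" where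
  "uvec w = (\<chi> i. up (\<lambda>n. w n $ i))"

lemma umat_nth [simp]: "umat A $ i $ j = up (\<lambda>n. A n $ i $ j)"
  by (simp add: umat_def)

lemma uvec_nth [simp]: "uvec w $ i = up (\<lambda>n. w n $ i)"
  by (simp add: uvec_def)

lemma umat_mult: "umat (\<lambda>n. A n ** B n) = umat A ** umat B"
  by (simp add: mat_eq_iff_2 matrix_mult_2_nth up_simps)

lemma umat_uvec: "uvec (\<lambda>n. A n *v w n) = umat A *v uvec w"
  by (simp add: vec_eq_iff_2 matrix_vector_mult_2_nth up_simps)

lemma uvec_scalar: "uvec (\<lambda>n. c n *s w n) = up c *s uvec w"
  by (simp add: vec_eq_iff_2 up_simps)

lemma det_umat: "det (umat A) = up (\<lambda>n. det (A n))"
  by (simp add: det_2 up_simps)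

lemma umat_eq_iff: "umat A = umat B \<longleftrightarrow> (\<forall>\<^sub>F n in free_ultrafilter. A n = B n)"
  by (simp add: mat_eq_iff_2 up_eq_iff eventually_conj_iff)

lemma uvec_eq_0_iff: "uvec w = 0 \<longleftrightarrow> (\<forall>\<^sub>F n in free_ultrafilter. w n = 0)"
  by (simp add: vec_eq_iff_2 up_eq_iff eventually_conj_iff flip: up_0)

lemma umat_hyperbolic:
  "umat (\<lambda>n. hyperbolic a (t n)) = hyperbolic (up (\<lambda>_. a)) (up t)"
  by (simp add: mat_eq_iff_2 hyperbolic_def up_simps)

text \<open>Eigenvectors exist at every index, and nonzero vectors at every index represent a nonzero vector.\<close>
lemma ex_eigenvector_umat:
  fixes A :: "nat \<Rightarrow> 'a::alg_closed_field^2^2"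
  obtains w c where "w \<noteq> 0" "umat A *v w = c *s w"
proof -
  have "\<exists>w c. w \<noteq> 0 \<and> A n *v w = c *s w" for n
    using ex_eigenvector_2 by metis
  then obtain w c where wc: "\<And>n. w n \<noteq> 0" "\<And>n. A n *v w n = c n *s w n"
    by metis
  show thesis
  proof
    show "uvec w \<noteq> 0" using wc(1) by (simp add: uvec_eq_0_iff)
    show "umat A *v uvec w = up c *s uvec w"
      by (simp add: wc(2) flip: umat_uvec uvec_scalar)
  qed
qed

section \<open>The amenable group\<close>

lemma nat_coded_group:
  fixes \<Gamma> :: "'g monoid"
  assumes "group \<Gamma>" "countable (carrier \<Gamma>)"
  obtains G :: "nat monoid" and \<theta> where "group G" "bij_betw \<theta> (carrier G) (carrier \<Gamma>)"
    "\<And>x y. x \<in> carrier G \<Longrightarrow> y \<in> carrier G \<Longrightarrow> \<theta> (x \<otimes>\<^bsub>G\<^esub> y) = \<theta> x \<otimes>\<^bsub>\<Gamma>\<^esub> \<theta> y"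
proof -
  interpret \<Gamma>: group \<Gamma> by fact
  define f where "f = to_nat_on (carrier \<Gamma>)"
  define \<theta> where "\<theta> = from_nat_into (carrier \<Gamma>)"
  have \<theta>f [simp]: "\<theta> (f x) = x" if "x \<in> carrier \<Gamma>" for x
    using that assms(2) by (simp add: f_def \<theta>_def)
  define G where "G = \<lparr>carrier = f ` carrier \<Gamma>, monoid.mult = \<lambda>x y. f (\<theta> x \<otimes>\<^bsub>\<Gamma>\<^esub> \<theta> y), monoid.one = f \<one>\<^bsub>\<Gamma>\<^esub>\<rparr>"
  have G [simp]: "carrier G = f ` carrier \<Gamma>" "x \<otimes>\<^bsub>G\<^esub> y = f (\<theta> x \<otimes>\<^bsub>\<Gamma>\<^esub> \<theta> y)" "\<one>\<^bsub>G\<^esub> = f \<one>\<^bsub>\<Gamma>\<^esub>" for x y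
    by (simp_all add: G_def)
  have "group G"
  proof (rule groupI)
    fix x assume "x \<in> carrier G"
    then obtain a where "x = f a" "a \<in> carrier \<Gamma>" by auto
    then show "\<exists>y\<in>carrier G. y \<otimes>\<^bsub>G\<^esub> x = \<one>\<^bsub>G\<^esub>"
      by (intro bexI[of _ "f (inv\<^bsub>\<Gamma>\<^esub> a)"]) auto
  qed (auto simp: \<Gamma>.m_assoc)
  moreover have "bij_betw \<theta> (carrier G) (carrier \<Gamma>)"
    by (rule bij_betw_byWitness[where f' = f]) auto
  moreover have "\<theta> (x \<otimes>\<^bsub>G\<^esub> y) = \<theta> x \<otimes>\<^bsub>\<Gamma>\<^esub> \<theta> y" if "x \<in> carrier G" "y \<in> carrier G" for x y
    using that by auto
  ultimately show thesis by (rule that)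
qed

lemma finite_matrices_2:
  assumes "finite S"
  shows "finite {A :: 'a::zero^2^2. \<forall>i j. A $ i $ j \<in> S}"
proof (rule finite_subset)
  show "{A :: 'a^2^2. \<forall>i j. A $ i $ j \<in> S} \<subseteq> (\<lambda>(a, b, c, d). mat2 a b c d) ` (S \<times> S \<times> S \<times> S)"
  proof
    fix A :: "'a^2^2" assume "A \<in> {A. \<forall>i j. A $ i $ j \<in> S}"
    then show "A \<in> (\<lambda>(a, b, c, d). mat2 a b c d) ` (S \<times> S \<times> S \<times> S)"
      by (intro image_eqI[of _ _ "(A$1$1, A$1$2, A$2$1, A$2$2)"]) (auto simp: mat_eq_iff_2)
  qed
  show "finite ((\<lambda>(a, b, c, d). mat2 a b c d) ` (S \<times> S \<times> S \<times> S))"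
    using assms by blast
qed

text \<open>The groups of the final statement live on the natural numbers; a copy of \<open>SL\<^sub>2(k)\<close> is described
  by its isomorphism \<open>\<theta>\<close> with the group of matrices.\<close>
locale SL2_copy = group G for G :: "'g monoid" (structure) +
  fixes \<theta> :: "'g \<Rightarrow> bit alg_closure^2^2"
  assumes bij: "bij_betw \<theta> (carrier G) (carrier SL2)"
    and hom: "x \<in> carrier G \<Longrightarrow> y \<in> carrier G \<Longrightarrow> \<theta> (x \<otimes> y) = \<theta> x ** \<theta> y"
begin

lemma group_hom_\<theta>: "group_hom G SL2 \<theta>"
  using bij hom by (auto simp: group_hom_def group_hom_axioms_def group_SL2 hom_def bij_betw_def is_group)

lemma \<theta>_one: "\<theta> \<one> = mat 1"
  using group_hom.hom_one[OF group_hom_\<theta>] by simp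

lemma \<theta>_eq_iff: "x \<in> carrier G \<Longrightarrow> y \<in> carrier G \<Longrightarrow> \<theta> x = \<theta> y \<longleftrightarrow> x = y"
  using bij by (auto simp: bij_betw_def inj_on_def)

lemma det_\<theta>: "x \<in> carrier G \<Longrightarrow> det (\<theta> x) = 1"
  using bij by (auto simp: bij_betw_def)

lemma \<theta>_surj:
  assumes "det A = 1" obtains x where "x \<in> carrier G" "\<theta> x = A"
proof -
  have "A \<in> \<theta> ` carrier G"
    using bij assms by (simp add: bij_betw_def)
  with that show thesis by blast
qed

lemma amenable: "amenable_group G"
proof (rule amenable_group_locally_finite)
  show "group G" by (rule is_group)
  define F where "F n = {x \<in> carrier G. \<forall>i j. \<theta> x $ i $ j \<in> finite_subfield n}" for n
  show "finite (F n)" for n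
  proof (rule finite_imageD)
    show "inj_on \<theta> (F n)"
      using \<theta>_eq_iff by (auto simp: inj_on_def F_def)
    show "finite (\<theta> ` F n)"
      by (rule finite_subset[OF _ finite_matrices_2[OF finite_finite_subfield[of n]]]) (auto simp: F_def)
  qed
  have "\<one> \<in> F n" for n
    using finite_subfield_closed by (auto simp: F_def \<theta>_one forall_2)
  then show "F n \<noteq> {}" for n by blast
  show "F n \<subseteq> carrier G" for n by (auto simp: F_def)
  fix g assume g: "g \<in> carrier G"
  have "\<forall>\<^sub>F n in sequentially. \<forall>i j. \<theta> g $ i $ j \<in> finite_subfield n"
    by (simp add: forall_2 eventually_conj_iff eventually_in_finite_subfield)
  then show "\<forall>\<^sub>F n in sequentially. \<forall>x\<in>F n. g \<otimes> x \<in> F n"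
    by eventually_elim
      (auto simp: F_def hom g matrix_mult_2_nth intro!: finite_subfield_closed)
qed

lemma icc: "icc G"
  unfolding icc_def
proof (intro conjI ballI)
  interpret \<theta>: group_hom G SL2 \<theta> by (rule group_hom_\<theta>)
  obtain u where u: "u \<in> carrier G" "\<theta> u = mat2 1 1 0 1"
    by (rule \<theta>_surj[of "mat2 1 1 0 1"]) (simp add: det_2)
  then have "u \<noteq> \<one>"
    using \<theta>_one by (auto simp: mat_eq_iff_2)
  with u show "carrier G \<noteq> {\<one>}" by blast
  fix x assume "x \<in> nonidentity G"
  then have x: "x \<in> carrier G" "x \<noteq> \<one>" by (auto simp: nonidentity_def)
  have "{B \<otimes>\<^bsub>SL2\<^esub> \<theta> x \<otimes>\<^bsub>SL2\<^esub> inv\<^bsub>SL2\<^esub> B | B. B \<in> carrier SL2} \<subseteq> \<theta> ` orbit G (conjugation G) x"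
  proof clarify
    fix B :: "bit alg_closure^2^2" assume "B \<in> carrier SL2"
    then obtain b where b: "b \<in> carrier G" "\<theta> b = B"
      using \<theta>_surj by auto
    then have "B \<otimes>\<^bsub>SL2\<^esub> \<theta> x \<otimes>\<^bsub>SL2\<^esub> inv\<^bsub>SL2\<^esub> B = \<theta> (b \<otimes> x \<otimes> inv b)"
      using x \<theta>.hom_inv[OF b(1)] by (simp add: hom)
    moreover have "b \<otimes> x \<otimes> inv b \<in> orbit G (conjugation G) x"
      using b x by (auto simp: orbit_def conjugation_def)
    ultimately show "B \<otimes>\<^bsub>SL2\<^esub> \<theta> x \<otimes>\<^bsub>SL2\<^esub> inv\<^bsub>SL2\<^esub> B \<in> \<theta> ` orbit G (conjugation G) x"
      by blast
  qed
  moreover have "\<theta> x \<noteq> mat 1"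
    using x \<theta>_eq_iff[of x \<one>] by (simp add: \<theta>_one)
  ultimately show "infinite (orbit G (conjugation G) x)"
    using infinite_conjugates_SL2[OF infinite_alg_closed_field two_eq_0_alg_closure_bit det_\<theta>[OF x(1)]]
      finite_subset finite_imageI by blast
qed

end

section \<open>The group that is not inner amenable\<close>

text \<open>The sequences of matrices \<open>hyperbolic (\<tau> j) (\<tau> n)\<close>, indexed by \<open>n\<close>, are put into the countable
  elementary subgroup \<open>H\<close> of the ultrapower. Over the ultrapower of \<open>k\<close> they are the matrices
  \<open>hyperbolic (a j) t\<close>, where \<open>a j\<close> is constant and \<open>t\<close> transcendental. The group \<open>H\<close> acts on vectors
  through the matrices \<open>M x\<close>, and ping-pong applies to the eigenvectors of these matrices.\<close>
lemma (in SL2_copy) ex_not_inner_amenable: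
  obtains H :: "nat monoid" where "group H" "elementarily_equivalent G H"
    "carrier H \<noteq> {\<one>\<^bsub>H\<^esub>}" "\<not> inner_amenable H"
proof -
  have "infinite (UNIV - {0 :: bit alg_closure})"
    by (rule infinite_remove[OF infinite_alg_closed_field])
  from infinite_countable_subset[OF this] obtain \<tau> :: "nat \<Rightarrow> bit alg_closure" where
    \<tau>: "inj \<tau>" and "range \<tau> \<subseteq> UNIV - {0}" by blast
  then have \<tau>_neq_0: "\<tau> n \<noteq> 0" for n by blast
  define s where "s j n = inv_into (carrier G) \<theta> (hyperbolic (\<tau> j) (\<tau> n))" for j n
  have hyp: "hyperbolic (\<tau> j) (\<tau> n) \<in> \<theta> ` carrier G" for j n
    using bij by (simp add: bij_betw_def det_hyperbolic \<tau>_neq_0)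
  have s: "s j n \<in> carrier G" "\<theta> (s j n) = hyperbolic (\<tau> j) (\<tau> n)" for j n
    unfolding s_def by (rule inv_into_into[OF hyp], rule f_inv_into_f[OF hyp])
  obtain H :: "nat monoid" and \<rho> where H: "group H" "elementarily_equivalent G H"
    and \<rho>: "\<And>x n. x \<in> carrier H \<Longrightarrow> \<rho> x n \<in> carrier G"
    and \<rho>_inj: "\<And>x y. x \<in> carrier H \<Longrightarrow> y \<in> carrier H \<Longrightarrow>
       \<forall>\<^sub>F n in free_ultrafilter. \<rho> x n = \<rho> y n \<Longrightarrow> x = y"
    and \<rho>_mult: "\<And>x y. x \<in> carrier H \<Longrightarrow> y \<in> carrier H \<Longrightarrow>
       \<forall>\<^sub>F n in free_ultrafilter. \<rho> (x \<otimes>\<^bsub>H\<^esub> y) n = \<rho> x n \<otimes> \<rho> y n"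
    and \<rho>_s: "\<And>j. \<exists>x\<in>carrier H. \<forall>\<^sub>F n in free_ultrafilter. \<rho> x n = s j n"
  proof (rule countable_elementary_subgroup_of_ultrapower[OF is_group, where s = s, OF s(1)], goal_cases)
    case (1 H \<rho>)
    show ?case by (rule 1(1)[OF 1(2-7)])
  qed
  interpret H: group H by fact
  define M where "M x = umat (\<lambda>n. \<theta> (\<rho> x n))" for x
  have M_mult: "M (x \<otimes>\<^bsub>H\<^esub> y) = M x ** M y" if "x \<in> carrier H" "y \<in> carrier H" for x y
  proof -
    have "M (x \<otimes>\<^bsub>H\<^esub> y) = umat (\<lambda>n. \<theta> (\<rho> x n) ** \<theta> (\<rho> y n))"
      unfolding M_def umat_eq_iff using \<rho>_mult[OF that]
      by eventually_elim (simp add: hom \<rho> that)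
    then show ?thesis by (simp add: M_def umat_mult)
  qed
  have M_inj: "x = y" if "x \<in> carrier H" "y \<in> carrier H" "M x = M y" for x y
    using that \<theta>_eq_iff[OF \<rho> \<rho>] by (intro \<rho>_inj) (auto simp: M_def umat_eq_iff)
  have det_M: "det (M x) = 1" if "x \<in> carrier H" for x
    using det_\<theta>[OF \<rho>[OF that]] by (simp add: M_def det_umat up_1)
  \<comment> \<open>\<open>M\<close> maps the identity to an idempotent element of \<open>SL\<^sub>2\<close>.\<close>
  have M_one: "M \<one>\<^bsub>H\<^esub> = mat 1"
  proof -
    have "M \<one>\<^bsub>H\<^esub> ** M \<one>\<^bsub>H\<^esub> = M \<one>\<^bsub>H\<^esub>"
      using M_mult[of "\<one>\<^bsub>H\<^esub>" "\<one>\<^bsub>H\<^esub>"] by simp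
    then show ?thesis
      using group.l_cancel_one[OF group_SL2, of "M \<one>\<^bsub>H\<^esub>" "M \<one>\<^bsub>H\<^esub>"] det_M by simp
  qed
  have M_inv: "M x *v (M (inv\<^bsub>H\<^esub> x) *v w) = w" "M (inv\<^bsub>H\<^esub> x) *v (M x *v w) = w"
    if "x \<in> carrier H" for x w
    using that by (simp_all add: matrix_vector_mul_assoc M_one flip: M_mult)

  define t where "t = up \<tau>"
  define a where "a i = up (\<lambda>_::nat. \<tau> i)" for i
  note R = transcendental_up[OF \<tau>]
  obtain V where V: "subring_of_field V" "\<And>x. x \<in> V \<or> inverse x \<in> V"
    and RV: "range (\<lambda>f. up (\<lambda>n. poly f (\<tau> n))) \<subseteq> V" and t: "inverse t \<notin> V"
    unfolding t_def
  proof (rule exists_valuation_ring[OF R(1,2,4)], goal_cases)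
    case (1 V)
    show ?case by (rule 1(1)[OF 1(2,5,3,4)])
  qed
  have const: "up (\<lambda>_. c) \<in> V" for c
    using RV R(3) by (rule subsetD)
  have "t \<in> V"
    unfolding t_def using RV R(2) by (rule subsetD)
  have a: "a i \<noteq> a j" "inverse (a i - a j) \<in> V" if "i < j" for i j
  proof -
    have "\<tau> i \<noteq> \<tau> j" using \<tau> that by (auto dest: injD)
    then show "a i \<noteq> a j" by (simp add: a_def up_eq_iff)
    have "inverse (a i - a j) = up (\<lambda>_. inverse (\<tau> i - \<tau> j))"
      by (simp add: a_def up_simps)
    then show "inverse (a i - a j) \<in> V" using const by simp
  qed
  have "\<forall>j. \<exists>x\<in>carrier H. M x = hyperbolic (a j) t"
  proof
    fix j
    obtain x where x: "x \<in> carrier H" "\<forall>\<^sub>F n in free_ultrafilter. \<rho> x n = s j n"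
      using \<rho>_s by blast
    have "M x = umat (\<lambda>n. hyperbolic (\<tau> j) (\<tau> n))"
      unfolding M_def umat_eq_iff using x(2) by eventually_elim (simp add: s)
    with x(1) show "\<exists>x\<in>carrier H. M x = hyperbolic (a j) t"
      by (auto simp: umat_hyperbolic a_def t_def)
  qed
  then obtain h where h: "\<And>j. h j \<in> carrier H" "\<And>j. M (h j) = hyperbolic (a j) t"
    by metis
  have two: "(2 :: bit alg_closure ultrapower) = 0"
    by (rule two_eq_0_ultrapower[OF two_eq_0_alg_closure_bit])

  define Fix where "Fix x = {w. w \<noteq> 0 \<and> (\<exists>c. M x *v w = c *s w)}" for x
  have "\<not> inner_amenable H"
  proof (rule not_inner_amenable_if_ping_pong[where Fix = Fix and g = h
      and act = "\<lambda>g w. M g *v w" and U = "\<lambda>i. near V t (a i)" and V = "\<lambda>i. near V t (a i + 1)"])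
    show "group H" by fact
    show "h i \<in> carrier H" for i by (rule h)
  next
    fix x
    obtain w c where "w \<noteq> 0" "M x *v w = c *s w"
      unfolding M_def by (rule ex_eigenvector_umat)
    then show "Fix x \<noteq> {}" by (auto simp: Fix_def)
  next
    fix g x assume g: "g \<in> carrier H" and "x \<in> nonidentity H"
    then have x: "x \<in> carrier H" by (simp add: nonidentity_def)
    show "Fix (g \<otimes>\<^bsub>H\<^esub> x \<otimes>\<^bsub>H\<^esub> inv\<^bsub>H\<^esub> g) \<subseteq> (*v) (M g) ` Fix x"
    proof
      fix w assume "w \<in> Fix (g \<otimes>\<^bsub>H\<^esub> x \<otimes>\<^bsub>H\<^esub> inv\<^bsub>H\<^esub> g)"
      then obtain c where w: "w \<noteq> 0" "M g *v (M x *v (M (inv\<^bsub>H\<^esub> g) *v w)) = c *s w"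
        using g x by (auto simp: Fix_def M_mult matrix_vector_mul_assoc matrix_mul_assoc)
      define w' where "w' = M (inv\<^bsub>H\<^esub> g) *v w"
      have "w = M g *v w'" using g by (simp add: w'_def M_inv)
      moreover have "w' \<noteq> 0" using w(1) \<open>w = M g *v w'\<close> by auto
      moreover have "M x *v w' = c *s w'"
        using arg_cong[OF w(2), of "(*v) (M (inv\<^bsub>H\<^esub> g))"] g
        by (simp add: M_inv w'_def vector_scalar_commute)
      ultimately show "w \<in> (*v) (M g) ` Fix x" by (auto simp: Fix_def)
    qed
  next
    fix i x w assume "w \<in> Fix x" "w \<notin> near V t (a i + 1)"
    then show "M (h i) *v w \<in> near V t (a i)"
      unfolding h(2) using V \<open>t \<in> V\<close> t by (intro hyperbolic_ping_pong) (auto simp: Fix_def)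
  next
    fix i j :: nat and w assume "i < j" "w \<in> near V t (a i)"
    then show "w \<notin> near V t (a j)"
      using near_disjoint[OF V(1) t a[of i j], of w w] by blast
  next
    fix i j k :: nat and x p q r
    assume ijk: "i < j" "j < k" and "x \<in> nonidentity H"
      and pq: "p \<in> Fix x \<inter> near V t (a i + 1)" "q \<in> Fix x \<inter> near V t (a j + 1)"
    then have x: "x \<in> carrier H" "x \<noteq> \<one>\<^bsub>H\<^esub>" by (auto simp: nonidentity_def)
    show "r \<notin> Fix x \<inter> near V t (a k + 1)"
    proof
      assume r: "r \<in> Fix x \<inter> near V t (a k + 1)"
      have distinct: "v$1 / v$2 \<noteq> w$1 / w$2"
        if "i < j" "v \<in> near V t (a i + 1)" "w \<in> near V t (a j + 1)" for i j v w
        using near_disjoint[OF V(1) t _ _ that(2,3)] a[OF that(1)] by simp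
      have slope: "(M x)$2$1 * z * z + ((M x)$2$2 - (M x)$1$1) * z = (M x)$1$2"
        if "z \<in> {p$1 / p$2, q$1 / q$2, r$1 / r$2}" for z
        using that pq r eigenvector_slope by (auto simp: Fix_def near_def)
      have slopes: "p$1 / p$2 \<noteq> q$1 / q$2" "p$1 / p$2 \<noteq> r$1 / r$2" "q$1 / q$2 \<noteq> r$1 / r$2"
        using distinct[of i j p q] distinct[of i k p r] distinct[of j k q r] ijk pq r by auto
      have "M x = mat 1"
        by (rule mat_1_if_three_slopes[OF det_M[OF x(1)] two _ slopes]) (rule slope)
      with x M_inj[of x "\<one>\<^bsub>H\<^esub>"] M_one show False by simp
    qed
  qed
  moreover have "carrier H \<noteq> {\<one>\<^bsub>H\<^esub>}"
  proof
    assume "carrier H = {\<one>\<^bsub>H\<^esub>}"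
    then have "h 0 = \<one>\<^bsub>H\<^esub>" using h(1) by blast
    then have "hyperbolic (a 0) t = mat 1" using h(2)[of 0] M_one by simp
    then have "t = inverse t"
      by (simp add: mat_eq_iff_2 hyperbolic_def inverse_eq_divide)
    with t \<open>t \<in> V\<close> show False by simp
  qed
  ultimately show thesis using that H by blast
qed

theorem theorem1p1:
  shows "\<exists>(G :: nat monoid) (H :: nat monoid).
    group G \<and> countable (carrier G) \<and> icc G \<and>
    group H \<and> countable (carrier H) \<and> icc H \<and>
    elementarily_equivalent G H \<and>
    amenable_group G \<and> \<not> inner_amenable H"
proof -
  have "countable {v :: bit alg_closure^2. \<forall>i. v $ i \<in> UNIV}"
    by (rule countable_vector) (rule countable_alg_closure_bit)
  then have "countable {A :: bit alg_closure^2^2. \<forall>i. A $ i \<in> UNIV}"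
    by (intro countable_vector) simp
  then have ct: "countable (carrier (SL2 :: (bit alg_closure^2^2) monoid))"
    by (rule countable_subset[rotated]) simp
  obtain G :: "nat monoid" and \<theta> :: "nat \<Rightarrow> bit alg_closure^2^2" where
    "group G" "bij_betw \<theta> (carrier G) (carrier SL2)"
    and "\<forall>x\<in>carrier G. \<forall>y\<in>carrier G. \<theta> (x \<otimes>\<^bsub>G\<^esub> y) = \<theta> x ** \<theta> y"
  proof (rule nat_coded_group[OF group_SL2 ct], goal_cases)
    case (1 G \<theta>)
    show ?case
      by (rule 1(1)[OF 1(2,3)]) (simp add: 1(4))
  qed
  then interpret SL2_copy G \<theta>
    by (simp add: SL2_copy_def SL2_copy_axioms_def)
  obtain H :: "nat monoid" where H: "group H" "elementarily_equivalent G H"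
    "carrier H \<noteq> {\<one>\<^bsub>H\<^esub>}" "\<not> inner_amenable H"
    by (rule ex_not_inner_amenable)
  have "icc H" using H by (intro icc_if_not_inner_amenable)
  with H icc amenable is_group show ?thesis
    by (intro exI[of _ G] exI[of _ H]) auto
qed

end
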